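(* Let $(C,\Delta,\varepsilon,\alpha)$ be a Hom-coalgebra over a field $k$ and let $\lambda,\nu\in k$. Then the following three linear maps $W,Z,X$ form a Hom-Yang-Baxter system (with $V=V'=C$ and $\alpha_V=\alpha_{V'}=\alpha$): $$W: C\otimes C\to C\otimes C,\qquad a\otimes b\mapsto \lambda\,\varepsilon(a)\,b_1\otimes b_2+\varepsilon(b)\,a_1\otimes a_2-\alpha(b)\otimes\alpha(a),$$ $$Z: C\otimes C\to C\otimes C,\qquad a\otimes b\mapsto \varepsilon(a)\,b_1\otimes b_2+\nu\,\varepsilon(b)\,a_1\otimes a_2-\alpha(b)\otimes\alpha(a),$$ $$X: C\otimes C\to C\otimes C,\qquad a\otimes b\mapsto \varepsilon(a)\,b_1\otimes b_2+\varepsilon(b)\,a_1\otimes a_2-\alpha(b)\otimes\alpha(a).$$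
   Context: Throughout, $k$ is a fixed field; vector spaces, linear maps and tensor products are over $k$, and $\tau$ denotes the flip $x\otimes y\mapsto y\otimes x$. Sweedler notation $\Delta(c)=c_1\otimes c_2$ (summation understood) is used, with $c_{11}\otimes c_{12}=\Delta(c_1)$, $c_{21}\otimes c_{22}=\Delta(c_2)$. A Hom-coalgebra is a quadruple $(C,\Delta,\varepsilon,\alpha)$ where $C$ is a $k$-linear space, $\Delta:C\to C\otimes C$ and $\varepsilon:C\to k$ are $k$-linear maps, and $\alpha:C\to C$ is a linear endomorphism, such that for all $c\in C$: $\alpha(c)_1\otimes\alpha(c)_2=\alpha(c_1)\otimes\alpha(c_2)$, $\varepsilon\circ\alpha=\varepsilon$, $\alpha(c_1)\otimes c_{21}\otimes c_{22}=c_{11}\otimes c_{12}\otimes\alpha(c_2)$, and $\varepsilon(c_1)c_2=c_1\varepsilon(c_2)=\alpha(c)$. Hom-Yang-Baxter commutator: let $V,V',V''$ be vector spaces with linear endomorphisms $\alpha_V,\alpha_{V'},\alpha_{V''}$, and let $R:V\otimes V'\to V\otimes V'$, $S:V\otimes V''\to V\otimes V''$, $T:V'\otimes V''\to V'\otimes V''$ be linear maps. The commutator $[R,S,T]:V\otimes V'\otimes V''\to V\otimes V'\otimes V''$ is $$[R,S,T]=R^{12}\circ S^{13}\circ T^{23}-T^{23}\circ S^{13}\circ R^{12},$$ where $R^{12}=R\otimes\alpha_{V''}$, $S^{13}=(\tau\otimes \mathrm{id})\circ(\alpha_{V'}\otimes S)\circ(\tau\otimes \mathrm{id})$ and $T^{23}=\alpha_V\otimes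 T$. Hom-Yang-Baxter system: let $V,V'$ be vector spaces with linear endomorphisms $\alpha_V,\alpha_{V'}$. A system of linear maps $W:V\otimes V\to V\otimes V$, $Z:V'\otimes V'\to V'\otimes V'$, $X:V\otimes V'\to V\otimes V'$ is called a Hom-Yang-Baxter system if $$[W,W,W]=0,\quad [Z,Z,Z]=0,\quad [W,X,X]=0,\quad [X,X,Z]=0.$$ *)

theory Defs
  imports "Jordan_Normal_Form.Missing_VectorSpace" "HOL-Algebra.AbelCoset"
begin

section \<open>Tensor products of vector spaces\<close>

text \<open>\<open>V \<otimes> W\<close> is the space of finite formal linear combinations of pairs in
  \<open>carrier V \<times> carrier W\<close>, modulo the span of the bilinearity relations; its elements are cosets.\<close>

definition free_space :: "('k, 'm) ring_scheme \<Rightarrow> 's set \<Rightarrow> ('k, 's \<Rightarrow> 'k) module"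
  where "free_space K S = (ring.func_space K S)
           \<lparr>carrier := {f \<in> S \<rightarrow>\<^sub>E carrier K. finite {s \<in> S. f s \<noteq> \<zero>\<^bsub>K\<^esub>}}\<rparr>"

definition free_gen :: "('k, 'm) ring_scheme \<Rightarrow> 's set \<Rightarrow> 's \<Rightarrow> 's \<Rightarrow> 'k"
  where "free_gen K S s = (\<lambda>t\<in>S. if t = s then \<one>\<^bsub>K\<^esub> else \<zero>\<^bsub>K\<^esub>)"

text \<open>The ring operations \<open>mult\<close> and \<open>one\<close> of a \<open>module\<close> record play no role in a vector space;
  they are given dummy values.\<close>

definition quotient_space ::
    "('k, 'm) ring_scheme \<Rightarrow> ('k, 'v, 'n) module_scheme \<Rightarrow> 'v set \<Rightarrow> ('k, 'v set) module"
  where "quotient_space K V N =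
    \<lparr>carrier = a_rcosets\<^bsub>V\<^esub> N, mult = (\<lambda>_ _. N), one = N,
     zero = N, add = (\<lambda>X Y. X <+>\<^bsub>V\<^esub> Y),
     smult = (\<lambda>c X. \<Union>x\<in>X. N +>\<^bsub>V\<^esub> (c \<odot>\<^bsub>V\<^esub> x))\<rparr>"

definition bilinear_relations :: "('k, 'm) ring_scheme \<Rightarrow> ('k, 'v, 'n) module_scheme \<Rightarrow>
    ('k, 'w, 'p) module_scheme \<Rightarrow> ('v \<times> 'w \<Rightarrow> 'k) set"
  where "bilinear_relations K V W =
    (let F = free_space K (carrier V \<times> carrier W);
         e = (\<lambda>v w. free_gen K (carrier V \<times> carrier W) (v, w))
     in {e (x \<oplus>\<^bsub>V\<^esub> y) w \<ominus>\<^bsub>F\<^esub> (e x w \<oplus>\<^bsub>F\<^esub> e y w) | x y w.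
           x \<in> carrier V \<and> y \<in> carrier V \<and> w \<in> carrier W} \<union>
        {e v (x \<oplus>\<^bsub>W\<^esub> y) \<ominus>\<^bsub>F\<^esub> (e v x \<oplus>\<^bsub>F\<^esub> e v y) | v x y.
           v \<in> carrier V \<and> x \<in> carrier W \<and> y \<in> carrier W} \<union>
        {e (c \<odot>\<^bsub>V\<^esub> v) w \<ominus>\<^bsub>F\<^esub> (c \<odot>\<^bsub>F\<^esub> e v w) | c v w.
           c \<in> carrier K \<and> v \<in> carrier V \<and> w \<in> carrier W} \<union>
        {e v (c \<odot>\<^bsub>W\<^esub> w) \<ominus>\<^bsub>F\<^esub> (c \<odot>\<^bsub>F\<^esub> e v w) | c v w.
           c \<in> carrier K \<and> v \<in> carrier V \<and> w \<in> carrier W})"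

definition tensor_space :: "('k, 'm) ring_scheme \<Rightarrow> ('k, 'v, 'n) module_scheme \<Rightarrow>
    ('k, 'w, 'p) module_scheme \<Rightarrow> ('k, ('v \<times> 'w \<Rightarrow> 'k) set) module"
  where "tensor_space K V W =
    (let F = free_space K (carrier V \<times> carrier W)
     in quotient_space K F (module.span K F (bilinear_relations K V W)))"

definition pure_tensor :: "('k, 'm) ring_scheme \<Rightarrow> ('k, 'v, 'n) module_scheme \<Rightarrow>
    ('k, 'w, 'p) module_scheme \<Rightarrow> 'v \<Rightarrow> 'w \<Rightarrow> ('v \<times> 'w \<Rightarrow> 'k) set"
  where "pure_tensor K V W v w =
    (let F = free_space K (carrier V \<times> carrier W)
     in module.span K F (bilinear_relations K V W)
          +>\<^bsub>F\<^esub> free_gen K (carrier V \<times> carrier W) (v, w))"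

text \<open>The linear map \<open>V \<otimes> W \<rightarrow> U\<close> given by \<open>v \<otimes> w \<mapsto> f v w\<close>, for bilinear \<open>f\<close>
  (\<open>extensional\<close> fixes the irrelevant values outside the carrier).\<close>

definition tensor_lift :: "('k, 'm) ring_scheme \<Rightarrow> ('k, 'v, 'n) module_scheme \<Rightarrow>
    ('k, 'w, 'p) module_scheme \<Rightarrow> ('k, 'u, 'q) module_scheme \<Rightarrow> ('v \<Rightarrow> 'w \<Rightarrow> 'u) \<Rightarrow>
    ('v \<times> 'w \<Rightarrow> 'k) set \<Rightarrow> 'u"
  where "tensor_lift K V W U f =
    (THE g. g \<in> extensional (carrier (tensor_space K V W)) \<and>
            linear_map K (tensor_space K V W) U g \<and>
            (\<forall>v\<in>carrier V. \<forall>w\<in>carrier W. g (pure_tensor K V W v w) = f v w))"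

text \<open>\<open>f \<otimes> g : V \<otimes> W \<rightarrow> V' \<otimes> W'\<close>\<close>

definition tensor_map :: "('k, 'm) ring_scheme \<Rightarrow> ('k, 'v, 'n) module_scheme \<Rightarrow>
    ('k, 'w, 'p) module_scheme \<Rightarrow> ('k, 'v1, 'n1) module_scheme \<Rightarrow>
    ('k, 'w1, 'p1) module_scheme \<Rightarrow> ('v \<Rightarrow> 'v1) \<Rightarrow> ('w \<Rightarrow> 'w1) \<Rightarrow>
    ('v \<times> 'w \<Rightarrow> 'k) set \<Rightarrow> ('v1 \<times> 'w1 \<Rightarrow> 'k) set"
  where "tensor_map K V W V' W' f g =
    tensor_lift K V W (tensor_space K V' W') (\<lambda>v w. pure_tensor K V' W' (f v) (g w))"

definition tensor_flip :: "('k, 'm) ring_scheme \<Rightarrow> ('k, 'v, 'n) module_scheme \<Rightarrow>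
    ('k, 'w, 'p) module_scheme \<Rightarrow> ('v \<times> 'w \<Rightarrow> 'k) set \<Rightarrow> ('w \<times> 'v \<Rightarrow> 'k) set"
  where "tensor_flip K V W =
    tensor_lift K V W (tensor_space K W V) (\<lambda>v w. pure_tensor K W V w v)"

text \<open>The canonical isomorphism \<open>(U \<otimes> V) \<otimes> W \<rightarrow> U \<otimes> (V \<otimes> W)\<close> and its inverse, which the
  informal notation \<open>U \<otimes> V \<otimes> W\<close> suppresses.\<close>

definition tensor_assoc :: "('k, 'm) ring_scheme \<Rightarrow> ('k, 'u, 'q) module_scheme \<Rightarrow>
    ('k, 'v, 'n) module_scheme \<Rightarrow> ('k, 'w, 'p) module_scheme \<Rightarrow>
    (('u \<times> 'v \<Rightarrow> 'k) set \<times> 'w \<Rightarrow> 'k) set \<Rightarrow> ('u \<times> ('v \<times> 'w \<Rightarrow> 'k) set \<Rightarrow> 'k) set"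
  where "tensor_assoc K U V W =
    (let UV = tensor_space K U V; VW = tensor_space K V W; U_VW = tensor_space K U VW
     in tensor_lift K UV W U_VW (\<lambda>x w.
          tensor_lift K U V U_VW (\<lambda>u v. pure_tensor K U VW u (pure_tensor K V W v w)) x))"

definition tensor_assoc_inv :: "('k, 'm) ring_scheme \<Rightarrow> ('k, 'u, 'q) module_scheme \<Rightarrow>
    ('k, 'v, 'n) module_scheme \<Rightarrow> ('k, 'w, 'p) module_scheme \<Rightarrow>
    ('u \<times> ('v \<times> 'w \<Rightarrow> 'k) set \<Rightarrow> 'k) set \<Rightarrow> (('u \<times> 'v \<Rightarrow> 'k) set \<times> 'w \<Rightarrow> 'k) set"
  where "tensor_assoc_inv K U V W =
    (let UV = tensor_space K U V; VW = tensor_space K V W; UV_W = tensor_space K UV W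
     in tensor_lift K U VW UV_W (\<lambda>u x.
          tensor_lift K V W UV_W (\<lambda>v w. pure_tensor K UV W (pure_tensor K U V u v) w) x))"

section \<open>Hom-coalgebras\<close>

definition scalar_space :: "('k, 'm) ring_scheme \<Rightarrow> ('k, 'k) module"
  where "scalar_space K =
    \<lparr>carrier = carrier K, mult = mult K, one = \<one>\<^bsub>K\<^esub>, zero = \<zero>\<^bsub>K\<^esub>, add = add K, smult = mult K\<rparr>"

text \<open>In Sweedler notation the last three axioms read
  \<open>\<alpha>(c\<^sub>1) \<otimes> c\<^sub>2\<^sub>1 \<otimes> c\<^sub>2\<^sub>2 = c\<^sub>1\<^sub>1 \<otimes> c\<^sub>1\<^sub>2 \<otimes> \<alpha>(c\<^sub>2)\<close> and \<open>\<epsilon>(c\<^sub>1)c\<^sub>2 = \<alpha>(c) = c\<^sub>1\<epsilon>(c\<^sub>2)\<close>.\<close>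

locale hom_coalgebra = vectorspace K C
  for K :: "('k, 'm) ring_scheme" and C :: "('k, 'c, 'n) module_scheme" +
  fixes \<Delta> :: "'c \<Rightarrow> ('c \<times> 'c \<Rightarrow> 'k) set" and \<epsilon> :: "'c \<Rightarrow> 'k" and \<alpha> :: "'c \<Rightarrow> 'c"
  assumes comult_linear: "linear_map K C (tensor_space K C C) \<Delta>"
    and counit_linear: "linear_map K C (scalar_space K) \<epsilon>"
    and twist_linear: "linear_map K C C \<alpha>"
    and comult_twist: "c \<in> carrier C \<Longrightarrow> \<Delta> (\<alpha> c) = tensor_map K C C C C \<alpha> \<alpha> (\<Delta> c)"
    and counit_twist: "c \<in> carrier C \<Longrightarrow> \<epsilon> (\<alpha> c) = \<epsilon> c"
    and hom_coassoc: "c \<in> carrier C \<Longrightarrow>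
      tensor_map K C C C (tensor_space K C C) \<alpha> \<Delta> (\<Delta> c) =
      tensor_assoc K C C C (tensor_map K C C (tensor_space K C C) C \<Delta> \<alpha> (\<Delta> c))"
    and hom_counit_left: "c \<in> carrier C \<Longrightarrow>
      tensor_lift K C C C (\<lambda>x y. \<epsilon> x \<odot>\<^bsub>C\<^esub> y) (\<Delta> c) = \<alpha> c"
    and hom_counit_right: "c \<in> carrier C \<Longrightarrow>
      tensor_lift K C C C (\<lambda>x y. \<epsilon> y \<odot>\<^bsub>C\<^esub> x) (\<Delta> c) = \<alpha> c"

section \<open>Hom-Yang-Baxter systems\<close>

text \<open>The commutator \<open>[R, S, T]\<close> on \<open>V \<otimes> V' \<otimes> V''\<close>, the latter read as \<open>(V \<otimes> V') \<otimes> V''\<close>.\<close>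

definition hyb_commutator :: "('k, 'm) ring_scheme \<Rightarrow> ('k, 'v, 'n) module_scheme \<Rightarrow>
    ('k, 'v1, 'n1) module_scheme \<Rightarrow> ('k, 'v2, 'n2) module_scheme \<Rightarrow>
    ('v \<Rightarrow> 'v) \<Rightarrow> ('v1 \<Rightarrow> 'v1) \<Rightarrow> ('v2 \<Rightarrow> 'v2) \<Rightarrow>
    (('v \<times> 'v1 \<Rightarrow> 'k) set \<Rightarrow> ('v \<times> 'v1 \<Rightarrow> 'k) set) \<Rightarrow>
    (('v \<times> 'v2 \<Rightarrow> 'k) set \<Rightarrow> ('v \<times> 'v2 \<Rightarrow> 'k) set) \<Rightarrow>
    (('v1 \<times> 'v2 \<Rightarrow> 'k) set \<Rightarrow> ('v1 \<times> 'v2 \<Rightarrow> 'k) set) \<Rightarrow>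
    (('v \<times> 'v1 \<Rightarrow> 'k) set \<times> 'v2 \<Rightarrow> 'k) set \<Rightarrow> (('v \<times> 'v1 \<Rightarrow> 'k) set \<times> 'v2 \<Rightarrow> 'k) set"
  where "hyb_commutator K V V' V'' \<alpha>V \<alpha>V' \<alpha>V'' R S T =
    (let VV' = tensor_space K V V'; V'V = tensor_space K V' V;
         VV'' = tensor_space K V V''; V'V'' = tensor_space K V' V'';
         R12 = tensor_map K VV' V'' VV' V'' R \<alpha>V'';
         S13 = tensor_map K V'V V'' VV' V'' (tensor_flip K V' V) (\<lambda>x. x)
               \<circ> (tensor_assoc_inv K V' V V'' \<circ> tensor_map K V' VV'' V' VV'' \<alpha>V' S
                    \<circ> tensor_assoc K V' V V'')
               \<circ> tensor_map K VV' V'' V'V V'' (tensor_flip K V V') (\<lambda>x. x);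
         T23 = tensor_assoc_inv K V V' V'' \<circ> tensor_map K V V'V'' V V'V'' \<alpha>V T
               \<circ> tensor_assoc K V V' V''
     in (\<lambda>x. (R12 \<circ> S13 \<circ> T23) x \<ominus>\<^bsub>tensor_space K VV' V''\<^esub> (T23 \<circ> S13 \<circ> R12) x))"

definition hyb_commutator_zero :: "('k, 'm) ring_scheme \<Rightarrow> ('k, 'v, 'n) module_scheme \<Rightarrow>
    ('k, 'v1, 'n1) module_scheme \<Rightarrow> ('k, 'v2, 'n2) module_scheme \<Rightarrow>
    ('v \<Rightarrow> 'v) \<Rightarrow> ('v1 \<Rightarrow> 'v1) \<Rightarrow> ('v2 \<Rightarrow> 'v2) \<Rightarrow>
    (('v \<times> 'v1 \<Rightarrow> 'k) set \<Rightarrow> ('v \<times> 'v1 \<Rightarrow> 'k) set) \<Rightarrow>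
    (('v \<times> 'v2 \<Rightarrow> 'k) set \<Rightarrow> ('v \<times> 'v2 \<Rightarrow> 'k) set) \<Rightarrow>
    (('v1 \<times> 'v2 \<Rightarrow> 'k) set \<Rightarrow> ('v1 \<times> 'v2 \<Rightarrow> 'k) set) \<Rightarrow> bool"
  where "hyb_commutator_zero K V V' V'' \<alpha>V \<alpha>V' \<alpha>V'' R S T \<longleftrightarrow>
    (let VV'V'' = tensor_space K (tensor_space K V V') V''
     in \<forall>x\<in>carrier VV'V''. hyb_commutator K V V' V'' \<alpha>V \<alpha>V' \<alpha>V'' R S T x = \<zero>\<^bsub>VV'V''\<^esub>)"

definition hom_yang_baxter_system :: "('k, 'm) ring_scheme \<Rightarrow> ('k, 'v, 'n) module_scheme \<Rightarrow>
    ('k, 'v1, 'n1) module_scheme \<Rightarrow> ('v \<Rightarrow> 'v) \<Rightarrow> ('v1 \<Rightarrow> 'v1) \<Rightarrow>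
    (('v \<times> 'v \<Rightarrow> 'k) set \<Rightarrow> ('v \<times> 'v \<Rightarrow> 'k) set) \<Rightarrow>
    (('v1 \<times> 'v1 \<Rightarrow> 'k) set \<Rightarrow> ('v1 \<times> 'v1 \<Rightarrow> 'k) set) \<Rightarrow>
    (('v \<times> 'v1 \<Rightarrow> 'k) set \<Rightarrow> ('v \<times> 'v1 \<Rightarrow> 'k) set) \<Rightarrow> bool"
  where "hom_yang_baxter_system K V V' \<alpha>V \<alpha>V' W Z X \<longleftrightarrow>
    linear_map K V V \<alpha>V \<and> linear_map K V' V' \<alpha>V' \<and>
    linear_map K (tensor_space K V V) (tensor_space K V V) W \<and>
    linear_map K (tensor_space K V' V') (tensor_space K V' V') Z \<and>
    linear_map K (tensor_space K V V') (tensor_space K V V') X \<and>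
    hyb_commutator_zero K V V V \<alpha>V \<alpha>V \<alpha>V W W W \<and>
    hyb_commutator_zero K V' V' V' \<alpha>V' \<alpha>V' \<alpha>V' Z Z Z \<and>
    hyb_commutator_zero K V V V' \<alpha>V \<alpha>V \<alpha>V' W X X \<and>
    hyb_commutator_zero K V V' V' \<alpha>V \<alpha>V' \<alpha>V' X X Z"

end

theory Submission
  imports Defs
begin

text \<open>
  The three maps belong to one family. For scalars \<open>p, q\<close> let
  \<open>F p q (a \<otimes> b) = p \<epsilon>(a) b\<^sub>1 \<otimes> b\<^sub>2 + q \<epsilon>(b) a\<^sub>1 \<otimes> a\<^sub>2 - \<alpha>(b) \<otimes> \<alpha>(a)\<close>;
  then \<open>W = F \<lambda> 1\<close>, \<open>X = F 1 1\<close> and \<open>Z = F 1 \<nu>\<close>. It therefore suffices to compute the commutator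
  \<open>[F p q, F r s, F t u]\<close> on a pure tensor \<open>a \<otimes> b \<otimes> c\<close>.

  Each of the two composites has 27 summands. The counit axioms turn a coproduct contracted with
  \<open>\<epsilon>\<close> into \<open>\<alpha>\<close>, comultiplicativity moves \<open>\<alpha>\<close> onto the Sweedler components, and Hom-coassociativity
  brings every iterated coproduct to the single form
  \<open>\<alpha>(c\<^sub>1\<^sub>1) \<otimes> \<alpha>(c\<^sub>1\<^sub>2) \<otimes> \<alpha>(\<alpha>(c\<^sub>2))\<close> (\<open>coprod3\<close>). All summands become multiples of the same ten
  tensors (\<open>braid_terms\<close>), and each composite becomes a combination of these whose coefficients are
  polynomials in the six scalars, times values of \<open>\<epsilon>\<close> (\<open>R12_S13_T23_comb\<close>, \<open>T23_S13_R12_comb\<close>).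
  Five of the ten pairs of coefficients agree identically; the other five pairs give the
  equations \<open>braid_scalars\<close>. Each of the four commutators of the theorem is an instance
  whose scalars solve them.

  An element of a tensor product is a coset, so the Sweedler notation \<open>f(c\<^sub>1, c\<^sub>2)\<close> for a bilinear \<open>f\<close>
  stands for \<open>tensor_lift\<close> of \<open>f\<close> applied to \<open>\<Delta> c\<close>. That this is a calculus at all rests on the
  universal property of the tensor product (\<open>tensor_lift_unique\<close>): linear maps commute with lifts,
  lifts are linear in the bilinear map, and the axioms of a Hom-coalgebra become rewrite rules
  for lifts (\<open>sw_counit_left\<close>, \<open>sw_counit_right\<close>, \<open>sw_twist\<close>, \<open>sw_coassoc\<close>).
\<close>

section \<open>Linear maps\<close>

lemma linear_mapI:
  assumes "vectorspace K V" "vectorspace K W"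
    and "\<And>x. x \<in> carrier V \<Longrightarrow> f x \<in> carrier W"
    and "\<And>x y. x \<in> carrier V \<Longrightarrow> y \<in> carrier V \<Longrightarrow> f (x \<oplus>\<^bsub>V\<^esub> y) = f x \<oplus>\<^bsub>W\<^esub> f y"
    and "\<And>c x. c \<in> carrier K \<Longrightarrow> x \<in> carrier V \<Longrightarrow> f (c \<odot>\<^bsub>V\<^esub> x) = c \<odot>\<^bsub>W\<^esub> f x"
  shows "linear_map K V W f"
proof -
  interpret V: vectorspace K V by fact
  interpret W: vectorspace K W by fact
  show ?thesis
    by unfold_locales (use assms(3-5) in \<open>auto simp: module_hom_def\<close>)
qed

lemma linear_mapD:
  assumes "linear_map K V W f"
  shows "vectorspace K V" "vectorspace K W"
    and "\<And>x. x \<in> carrier V \<Longrightarrow> f x \<in> carrier W"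
    and "\<And>x y. x \<in> carrier V \<Longrightarrow> y \<in> carrier V \<Longrightarrow> f (x \<oplus>\<^bsub>V\<^esub> y) = f x \<oplus>\<^bsub>W\<^esub> f y"
    and "\<And>x y. x \<in> carrier V \<Longrightarrow> y \<in> carrier V \<Longrightarrow> f (x \<ominus>\<^bsub>V\<^esub> y) = f x \<ominus>\<^bsub>W\<^esub> f y"
    and "\<And>c x. c \<in> carrier K \<Longrightarrow> x \<in> carrier V \<Longrightarrow> f (c \<odot>\<^bsub>V\<^esub> x) = c \<odot>\<^bsub>W\<^esub> f x"
    and "f \<zero>\<^bsub>V\<^esub> = \<zero>\<^bsub>W\<^esub>"
proof -
  interpret linear_map K V W f by fact
  show "vectorspace K V" "vectorspace K W" by unfold_locales
  show "f x \<in> carrier W" if "x \<in> carrier V" for x using that by simp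
  show "f (x \<oplus>\<^bsub>V\<^esub> y) = f x \<oplus>\<^bsub>W\<^esub> f y" "f (x \<ominus>\<^bsub>V\<^esub> y) = f x \<ominus>\<^bsub>W\<^esub> f y"
    if "x \<in> carrier V" "y \<in> carrier V" for x y using that by simp_all
  show "f (c \<odot>\<^bsub>V\<^esub> x) = c \<odot>\<^bsub>W\<^esub> f x" if "c \<in> carrier K" "x \<in> carrier V" for c x
    using that by simp
  show "f \<zero>\<^bsub>V\<^esub> = \<zero>\<^bsub>W\<^esub>" by simp
qed

section \<open>Free vector spaces\<close>

context field
begin

lemma free_space_simps:
  "carrier (free_space R S) = {f \<in> S \<rightarrow>\<^sub>E carrier R. finite {s \<in> S. f s \<noteq> \<zero>}}"
  "\<zero>\<^bsub>free_space R S\<^esub> = (\<lambda>s\<in>S. \<zero>)"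
  "f \<oplus>\<^bsub>free_space R S\<^esub> g = (\<lambda>s\<in>S. f s \<oplus> g s)"
  "c \<odot>\<^bsub>free_space R S\<^esub> f = (\<lambda>s\<in>S. c \<otimes> f s)"
  by (simp_all add: free_space_def func_space_def)

lemma free_space_vectorspace: "vectorspace R (free_space R S)"
proof -
  let ?N = "{f \<in> S \<rightarrow>\<^sub>E carrier R. finite {s \<in> S. f s \<noteq> \<zero>}}"
  have add: "finite {s \<in> S. (\<lambda>s\<in>S. f s \<oplus> g s) s \<noteq> \<zero>}"
    if "finite {s \<in> S. f s \<noteq> \<zero>}" "finite {s \<in> S. g s \<noteq> \<zero>}" for f g
    by (rule finite_subset[of _ "{s \<in> S. f s \<noteq> \<zero>} \<union> {s \<in> S. g s \<noteq> \<zero>}"]) (use that in auto)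
  have smult: "finite {s \<in> S. (\<lambda>s\<in>S. c \<otimes> f s) s \<noteq> \<zero>}"
    if "finite {s \<in> S. f s \<noteq> \<zero>}" "c \<in> carrier R" for f c
    by (rule finite_subset[of _ "{s \<in> S. f s \<noteq> \<zero>}"]) (use that in auto)
  have "submodule R ?N (func_space S)"
    by (rule submodule.intro) (use add smult func_space_is_module in \<open>auto simp: func_space_def\<close>)
  then have "module R (func_space S\<lparr>carrier := ?N\<rparr>)"
    by (rule module.submodule_is_module[OF func_space_is_module])
  then show ?thesis
    unfolding free_space_def vectorspace_def using field_axioms by simp
qed

lemma free_gen_in_carrier: "s \<in> S \<Longrightarrow> free_gen R S s \<in> carrier (free_space R S)"
proof -
  assume "s \<in> S"
  moreover have "finite {t \<in> S. free_gen R S s t \<noteq> \<zero>}"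
    by (rule finite_subset[of _ "{s}"]) (auto simp: free_gen_def)
  ultimately show ?thesis
    by (auto simp: free_space_simps free_gen_def)
qed

text \<open>Induction on the size of the support: clearing one value of \<open>f\<close> splits off a multiple of a
  generator and leaves a function with smaller support.\<close>

lemma free_space_induct [consumes 1, case_names zero add]:
  assumes "f \<in> carrier (free_space R S)"
    and "P (\<zero>\<^bsub>free_space R S\<^esub>)"
    and step: "\<And>c s g. c \<in> carrier R \<Longrightarrow> s \<in> S \<Longrightarrow> g \<in> carrier (free_space R S) \<Longrightarrow> P g \<Longrightarrow>
      P (c \<odot>\<^bsub>free_space R S\<^esub> free_gen R S s \<oplus>\<^bsub>free_space R S\<^esub> g)"
  shows "P f"
  using assms(1)
proof (induction "card {s \<in> S. f s \<noteq> \<zero>}" arbitrary: f)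
  case 0
  then have "{s \<in> S. f s \<noteq> \<zero>} = {}" by (auto simp: free_space_simps)
  then have "f = \<zero>\<^bsub>free_space R S\<^esub>"
    using 0(2) by (auto simp: free_space_simps PiE_def extensional_def fun_eq_iff)
  then show ?case using assms(2) by simp
next
  case (Suc n)
  then have "{s \<in> S. f s \<noteq> \<zero>} \<noteq> {}" by force
  then obtain s where s: "s \<in> S" "f s \<noteq> \<zero>" by blast
  define g where "g = f(s := \<zero>)"
  have supp: "{t \<in> S. g t \<noteq> \<zero>} = {t \<in> S. f t \<noteq> \<zero>} - {s}"
    by (auto simp: g_def)
  have fin: "finite {t \<in> S. f t \<noteq> \<zero>}" using Suc.prems by (simp add: free_space_simps)
  have g: "g \<in> carrier (free_space R S)"
    using Suc.prems s fin supp by (auto simp: free_space_simps g_def PiE_def extensional_def)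
  have "card {t \<in> S. g t \<noteq> \<zero>} = n"
    using Suc.hyps(2) s fin by (simp add: supp)
  with Suc.hyps(1) g have "P g" by blast
  moreover have "f = f s \<odot>\<^bsub>free_space R S\<^esub> free_gen R S s \<oplus>\<^bsub>free_space R S\<^esub> g"
    using Suc.prems s
    by (auto simp: free_space_simps free_gen_def g_def fun_eq_iff PiE_def extensional_def Pi_def)
  moreover have "f s \<in> carrier R" using Suc.prems s by (auto simp: free_space_simps)
  ultimately show ?case using step[of "f s" s g] s g by simp
qed

end

definition free_lift where
  "free_lift K S U h f = (\<Oplus>\<^bsub>U\<^esub>s\<in>{s \<in> S. f s \<noteq> \<zero>\<^bsub>K\<^esub>}. f s \<odot>\<^bsub>U\<^esub> h s)"

text \<open>The support of a sum is not the union of the supports, so the linearity of \<open>free_lift\<close> needs sums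
  over a common finite set of indices; the additional summands vanish.\<close>

lemma free_lift_superset:
  assumes U: "vectorspace K U" and h: "h \<in> S \<rightarrow> carrier U" and f: "f \<in> S \<rightarrow> carrier K"
    and T: "finite T" "T \<subseteq> S" "{s \<in> S. f s \<noteq> \<zero>\<^bsub>K\<^esub>} \<subseteq> T"
  shows "free_lift K S U h f = (\<Oplus>\<^bsub>U\<^esub>s\<in>T. f s \<odot>\<^bsub>U\<^esub> h s)"
proof -
  interpret vectorspace K U by fact
  show ?thesis
    unfolding free_lift_def
  proof (rule M.add.finprod_mono_neutral_cong_left)
    show "f s \<odot>\<^bsub>U\<^esub> h s = \<zero>\<^bsub>U\<^esub>" if "s \<in> T - {s \<in> S. f s \<noteq> \<zero>\<^bsub>K\<^esub>}" for s
      using that T h by (auto simp: Pi_iff)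
  qed (use T f h in \<open>auto simp: Pi_iff\<close>)
qed

lemma free_lift_linear:
  assumes U: "vectorspace K U" and h: "h \<in> S \<rightarrow> carrier U"
  shows "linear_map K (free_space K S) U (free_lift K S U h)"
proof -
  interpret U: vectorspace K U by fact
  note fs = U.free_space_simps
  let ?F = "free_space K S" and ?L = "free_lift K S U h"
  show ?thesis
  proof (rule linear_mapI)
    show "vectorspace K ?F" by (rule U.free_space_vectorspace)
    show "?L f \<in> carrier U" if "f \<in> carrier ?F" for f
      unfolding free_lift_def using that h by (intro U.M.finsum_closed) (auto simp: fs Pi_iff PiE_iff)
    show "?L (f \<oplus>\<^bsub>?F\<^esub> g) = ?L f \<oplus>\<^bsub>U\<^esub> ?L g"
      if f: "f \<in> carrier ?F" and g: "g \<in> carrier ?F" for f g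
    proof -
      let ?T = "{s \<in> S. f s \<noteq> \<zero>\<^bsub>K\<^esub>} \<union> {s \<in> S. g s \<noteq> \<zero>\<^bsub>K\<^esub>}"
      have fg: "f \<in> S \<rightarrow> carrier K" "g \<in> S \<rightarrow> carrier K" "finite ?T" "?T \<subseteq> S"
        using f g by (auto simp: fs)
      have "?L (f \<oplus>\<^bsub>?F\<^esub> g) = (\<Oplus>\<^bsub>U\<^esub>s\<in>?T. (f \<oplus>\<^bsub>?F\<^esub> g) s \<odot>\<^bsub>U\<^esub> h s)"
        by (rule free_lift_superset[OF U h]) (use fg in \<open>auto simp: fs\<close>)
      also have "\<dots> = (\<Oplus>\<^bsub>U\<^esub>s\<in>?T. f s \<odot>\<^bsub>U\<^esub> h s \<oplus>\<^bsub>U\<^esub> g s \<odot>\<^bsub>U\<^esub> h s)"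
        by (rule U.M.finsum_cong') (use fg h in \<open>auto simp: fs U.smult_l_distr Pi_iff\<close>)
      also have "\<dots> = (\<Oplus>\<^bsub>U\<^esub>s\<in>?T. f s \<odot>\<^bsub>U\<^esub> h s) \<oplus>\<^bsub>U\<^esub> (\<Oplus>\<^bsub>U\<^esub>s\<in>?T. g s \<odot>\<^bsub>U\<^esub> h s)"
        by (rule U.M.finsum_addf) (use fg h in \<open>auto simp: Pi_iff\<close>)
      also have "\<dots> = ?L f \<oplus>\<^bsub>U\<^esub> ?L g"
        by (subst (1 2) free_lift_superset[OF U h, where T = ?T]) (use fg in auto)
      finally show ?thesis .
    qed
    show "?L (c \<odot>\<^bsub>?F\<^esub> f) = c \<odot>\<^bsub>U\<^esub> ?L f" if c: "c \<in> carrier K" and f: "f \<in> carrier ?F" for c f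
    proof -
      let ?T = "{s \<in> S. f s \<noteq> \<zero>\<^bsub>K\<^esub>}"
      have fg: "f \<in> S \<rightarrow> carrier K" "finite ?T"
        using f by (auto simp: fs)
      have "?L (c \<odot>\<^bsub>?F\<^esub> f) = (\<Oplus>\<^bsub>U\<^esub>s\<in>?T. (c \<odot>\<^bsub>?F\<^esub> f) s \<odot>\<^bsub>U\<^esub> h s)"
        by (rule free_lift_superset[OF U h]) (use fg c in \<open>auto simp: fs\<close>)
      also have "\<dots> = (\<Oplus>\<^bsub>U\<^esub>s\<in>?T. c \<odot>\<^bsub>U\<^esub> (f s \<odot>\<^bsub>U\<^esub> h s))"
        by (rule U.M.finsum_cong') (use fg h c in \<open>auto simp: fs U.smult_assoc1 Pi_iff\<close>)
      also have "\<dots> = c \<odot>\<^bsub>U\<^esub> ?L f"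
        unfolding free_lift_def
        by (rule U.finsum_smult[symmetric]) (use c fg h in \<open>auto simp: Pi_iff\<close>)
      finally show ?thesis .
    qed
  qed (fact U)
qed

lemma free_lift_gen:
  assumes U: "vectorspace K U" and h: "h \<in> S \<rightarrow> carrier U" and s: "s \<in> S"
  shows "free_lift K S U h (free_gen K S s) = h s"
proof -
  interpret U: vectorspace K U by fact
  have "free_lift K S U h (free_gen K S s) = (\<Oplus>\<^bsub>U\<^esub>t\<in>{s}. free_gen K S s t \<odot>\<^bsub>U\<^esub> h t)"
    by (rule free_lift_superset[OF U h]) (use s in \<open>auto simp: free_gen_def\<close>)
  also have "\<dots> = h s"
    using s h by (simp add: free_gen_def Pi_iff)
  finally show ?thesis .
qed

section \<open>Quotient spaces\<close>

context vectorspace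
begin

text \<open>Closure under scalars includes closure under \<open>-1\<close>, that is, under negation.\<close>

lemma submodule_abelian_subgroup:
  assumes "submodule K N V"
  shows "abelian_subgroup N V"
proof -
  interpret N: submodule K N V by fact
  have neg: "\<ominus>\<^bsub>V\<^esub> x \<in> N" if "x \<in> N" for x
  proof -
    have "x \<in> carrier V" using N.subset that by auto
    then have "\<ominus>\<^bsub>V\<^esub> x = (\<ominus>\<^bsub>K\<^esub> \<one>\<^bsub>K\<^esub>) \<odot>\<^bsub>V\<^esub> x" by (simp add: smult_minus_1)
    then show ?thesis using that by simp
  qed
  have "subgroup N (add_monoid V)"
    by (rule M.add.subgroupI[OF N.subset]) (use N.zero_closed N.m_closed neg in blast)+
  then show ?thesis
    by (intro abelian_subgroupI3 additive_subgroupI) (auto intro: M.abelian_group_axioms)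
qed

context
  fixes N assumes N: "submodule K N V"
begin

interpretation N: abelian_subgroup N V
  by (rule submodule_abelian_subgroup[OF N])

lemma coset_eq_iff:
  assumes "x \<in> carrier V" "y \<in> carrier V"
  shows "N +>\<^bsub>V\<^esub> x = N +>\<^bsub>V\<^esub> y \<longleftrightarrow> x \<ominus>\<^bsub>V\<^esub> y \<in> N"
proof -
  have "x \<ominus>\<^bsub>V\<^esub> y \<in> N \<longleftrightarrow> x \<in> N +>\<^bsub>V\<^esub> y"
    using assms N.a_rcos_module[of y x] by (simp add: a_minus_def)
  also have "\<dots> \<longleftrightarrow> N +>\<^bsub>V\<^esub> x = N +>\<^bsub>V\<^esub> y"
    using assms N.a_repr_independence' N.a_rcos_self by metis
  finally show ?thesis by simp
qed

text \<open>The quotient operations are unions over representatives; on cosets given by a representative they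
  are computed from that representative, since all members of the union coincide.\<close>

lemma quotient_space_simps:
  "carrier (quotient_space K V N) = (\<lambda>x. N +>\<^bsub>V\<^esub> x) ` carrier V"
  "\<zero>\<^bsub>quotient_space K V N\<^esub> = N +>\<^bsub>V\<^esub> \<zero>\<^bsub>V\<^esub>"
  "x \<in> carrier V \<Longrightarrow> y \<in> carrier V \<Longrightarrow>
     (N +>\<^bsub>V\<^esub> x) \<oplus>\<^bsub>quotient_space K V N\<^esub> (N +>\<^bsub>V\<^esub> y) = N +>\<^bsub>V\<^esub> (x \<oplus>\<^bsub>V\<^esub> y)"
  "c \<in> carrier K \<Longrightarrow> x \<in> carrier V \<Longrightarrow>
     c \<odot>\<^bsub>quotient_space K V N\<^esub> (N +>\<^bsub>V\<^esub> x) = N +>\<^bsub>V\<^esub> (c \<odot>\<^bsub>V\<^esub> x)"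
proof -
  show "carrier (quotient_space K V N) = (\<lambda>x. N +>\<^bsub>V\<^esub> x) ` carrier V"
    by (auto simp: quotient_space_def A_RCOSETS_def')
  show "\<zero>\<^bsub>quotient_space K V N\<^esub> = N +>\<^bsub>V\<^esub> \<zero>\<^bsub>V\<^esub>"
    by (simp add: quotient_space_def N.a_subset)
  show "(N +>\<^bsub>V\<^esub> x) \<oplus>\<^bsub>quotient_space K V N\<^esub> (N +>\<^bsub>V\<^esub> y) = N +>\<^bsub>V\<^esub> (x \<oplus>\<^bsub>V\<^esub> y)"
    if "x \<in> carrier V" "y \<in> carrier V"
    using that by (simp add: quotient_space_def N.a_rcos_sum)
  show "c \<odot>\<^bsub>quotient_space K V N\<^esub> (N +>\<^bsub>V\<^esub> x) = N +>\<^bsub>V\<^esub> (c \<odot>\<^bsub>V\<^esub> x)"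
    if c: "c \<in> carrier K" and x: "x \<in> carrier V"
  proof -
    have "N +>\<^bsub>V\<^esub> (c \<odot>\<^bsub>V\<^esub> z) = N +>\<^bsub>V\<^esub> (c \<odot>\<^bsub>V\<^esub> x)" if z: "z \<in> N +>\<^bsub>V\<^esub> x" for z
    proof -
      have zV: "z \<in> carrier V" using N.a_elemrcos_carrier x z by blast
      have "z \<ominus>\<^bsub>V\<^esub> x \<in> N" using N.a_rcos_module_imp x z by (simp add: a_minus_def)
      then have "c \<odot>\<^bsub>V\<^esub> (z \<ominus>\<^bsub>V\<^esub> x) \<in> N" using submodule.smult_closed[OF N] c by simp
      moreover have "c \<odot>\<^bsub>V\<^esub> (z \<ominus>\<^bsub>V\<^esub> x) = c \<odot>\<^bsub>V\<^esub> z \<ominus>\<^bsub>V\<^esub> c \<odot>\<^bsub>V\<^esub> x"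
        using c x zV by (simp add: a_minus_def smult_r_distr smult_r_minus)
      ultimately show ?thesis using coset_eq_iff c x zV by simp
    qed
    then have "(\<Union>z\<in>N +>\<^bsub>V\<^esub> x. N +>\<^bsub>V\<^esub> (c \<odot>\<^bsub>V\<^esub> z)) = (\<Union>z\<in>N +>\<^bsub>V\<^esub> x. N +>\<^bsub>V\<^esub> (c \<odot>\<^bsub>V\<^esub> x))"
      by (rule SUP_cong[OF refl])
    also have "\<dots> = N +>\<^bsub>V\<^esub> (c \<odot>\<^bsub>V\<^esub> x)"
      using N.a_rcos_self[OF x] by blast
    finally show ?thesis by (simp add: quotient_space_def)
  qed
qed

lemma quotient_vectorspace: "vectorspace K (quotient_space K V N)"
proof (rule vs_criteria)
  show "field K" by (rule field_axioms)
  note qs = quotient_space_simps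
  show "\<forall>v\<in>carrier (quotient_space K V N). \<exists>w\<in>carrier (quotient_space K V N).
      v \<oplus>\<^bsub>quotient_space K V N\<^esub> w = \<zero>\<^bsub>quotient_space K V N\<^esub>"
  proof
    fix v assume "v \<in> carrier (quotient_space K V N)"
    then obtain x where x: "x \<in> carrier V" "v = N +>\<^bsub>V\<^esub> x" by (auto simp: qs)
    then show "\<exists>w\<in>carrier (quotient_space K V N).
      v \<oplus>\<^bsub>quotient_space K V N\<^esub> w = \<zero>\<^bsub>quotient_space K V N\<^esub>"
      by (intro bexI[of _ "N +>\<^bsub>V\<^esub> (\<ominus>\<^bsub>V\<^esub> x)"]) (auto simp: qs M.r_neg)
  qed
qed (auto simp: quotient_space_simps M.a_ac smult_l_distr smult_r_distr smult_assoc1)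

text \<open>A linear map that vanishes on \<open>N\<close> has the same value on all representatives of a coset, so
  evaluating it at an arbitrary representative is well defined.\<close>

lemma quotient_lift_exists:
  assumes g: "linear_map K V U g" and vanish: "\<And>x. x \<in> N \<Longrightarrow> g x = \<zero>\<^bsub>U\<^esub>"
  shows "\<exists>q. linear_map K (quotient_space K V N) U q \<and> (\<forall>x\<in>carrier V. q (N +>\<^bsub>V\<^esub> x) = g x)"
proof -
  interpret U: vectorspace K U by (rule linear_mapD(2)[OF g])
  note gD = linear_mapD[OF g]
  define q where "q X = g (SOME x. x \<in> X)" for X
  have q: "q (N +>\<^bsub>V\<^esub> x) = g x" if x: "x \<in> carrier V" for x
  proof -
    define z where "z = (SOME z. z \<in> N +>\<^bsub>V\<^esub> x)"
    have z: "z \<in> N +>\<^bsub>V\<^esub> x"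
      unfolding z_def by (rule someI) (rule N.a_rcos_self[OF x])
    have zV: "z \<in> carrier V" using N.a_elemrcos_carrier x z by blast
    have "z \<ominus>\<^bsub>V\<^esub> x \<in> N" using N.a_rcos_module_imp x z by (simp add: a_minus_def)
    then have "g z \<ominus>\<^bsub>U\<^esub> g x = \<zero>\<^bsub>U\<^esub>" using vanish gD(5) zV x by metis
    then have "g z = g x" using gD(3) zV x by simp
    then show ?thesis by (simp add: q_def z_def)
  qed
  have "linear_map K (quotient_space K V N) U q"
    by (rule linear_mapI[OF quotient_vectorspace gD(2)])
      (auto simp: quotient_space_simps q gD)
  with q show ?thesis by blast
qed

end

end

section \<open>The universal property of the tensor product\<close>

text \<open>Separate linearity is phrased through \<open>linear_map\<close>, so that closure rules for linear maps are at
  the same time closure rules for bilinear ones.\<close>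

definition bilinear where
  "bilinear K V W U f \<longleftrightarrow> (\<forall>v\<in>carrier V. linear_map K W U (f v)) \<and>
     (\<forall>w\<in>carrier W. linear_map K V U (\<lambda>v. f v w))"

lemma bilinearI:
  assumes "\<And>v. v \<in> carrier V \<Longrightarrow> linear_map K W U (f v)"
    and "\<And>w. w \<in> carrier W \<Longrightarrow> linear_map K V U (\<lambda>v. f v w)"
  shows "bilinear K V W U f"
  using assms by (simp add: bilinear_def)

lemma bilinearD:
  assumes "bilinear K V W U f"
  shows "v \<in> carrier V \<Longrightarrow> linear_map K W U (f v)"
    and "w \<in> carrier W \<Longrightarrow> linear_map K V U (\<lambda>v. f v w)"
  using assms by (simp_all add: bilinear_def)

locale vectorspace_pair = V: vectorspace K V + W: vectorspace K W
  for K :: "('k, 'm) ring_scheme" and V :: "('k, 'v, 'n) module_scheme"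
    and W :: "('k, 'w, 'p) module_scheme"
begin

abbreviation "F \<equiv> free_space K (carrier V \<times> carrier W)"
abbreviation "e v w \<equiv> free_gen K (carrier V \<times> carrier W) (v, w)"
abbreviation "N \<equiv> module.span K F (bilinear_relations K V W)"
abbreviation "VW \<equiv> tensor_space K V W"
abbreviation "pt \<equiv> pure_tensor K V W"

sublocale F: vectorspace K F
  by (rule V.free_space_vectorspace)

lemma gen_closed [simp]: "v \<in> carrier V \<Longrightarrow> w \<in> carrier W \<Longrightarrow> e v w \<in> carrier F"
  by (simp add: V.free_gen_in_carrier)

lemma relations_subset: "bilinear_relations K V W \<subseteq> carrier F"
  unfolding bilinear_relations_def Let_def by auto

lemma span_submodule: "submodule K N F"
  by (rule F.span_is_submodule[OF relations_subset])

lemma relation_in_span: "r \<in> bilinear_relations K V W \<Longrightarrow> r \<in> N"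
  using F.in_own_span[OF relations_subset] by blast

lemma tensor_space_eq: "VW = quotient_space K F N"
  by (simp add: tensor_space_def Let_def)

lemma pure_tensor_eq: "pt v w = N +>\<^bsub>F\<^esub> e v w"
  by (simp add: pure_tensor_def Let_def)

lemmas quotient_simps = F.quotient_space_simps[OF span_submodule]

lemma tensor_vectorspace: "vectorspace K VW"
  unfolding tensor_space_eq by (rule F.quotient_vectorspace[OF span_submodule])

sublocale VW: vectorspace K VW
  by (rule tensor_vectorspace)

lemma pure_tensor_closed: "v \<in> carrier V \<Longrightarrow> w \<in> carrier W \<Longrightarrow> pt v w \<in> carrier VW"
  by (auto simp: tensor_space_eq pure_tensor_eq quotient_simps)

lemma pure_tensor_linear_left:
  assumes w: "w \<in> carrier W"
  shows "linear_map K V VW (\<lambda>v. pt v w)"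
proof (rule linear_mapI)
  show "pt (x \<oplus>\<^bsub>V\<^esub> y) w = pt x w \<oplus>\<^bsub>VW\<^esub> pt y w" if "x \<in> carrier V" "y \<in> carrier V" for x y
  proof -
    have "e (x \<oplus>\<^bsub>V\<^esub> y) w \<ominus>\<^bsub>F\<^esub> (e x w \<oplus>\<^bsub>F\<^esub> e y w) \<in> N"
      by (rule relation_in_span) (unfold bilinear_relations_def Let_def, use that w in blast)
    then show ?thesis
      using that w by (simp add: tensor_space_eq pure_tensor_eq quotient_simps
          F.coset_eq_iff[OF span_submodule])
  qed
  show "pt (c \<odot>\<^bsub>V\<^esub> x) w = c \<odot>\<^bsub>VW\<^esub> pt x w" if "c \<in> carrier K" "x \<in> carrier V" for c x
  proof -
    have "e (c \<odot>\<^bsub>V\<^esub> x) w \<ominus>\<^bsub>F\<^esub> (c \<odot>\<^bsub>F\<^esub> e x w) \<in> N"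
      by (rule relation_in_span) (unfold bilinear_relations_def Let_def, use that w in blast)
    then show ?thesis
      using that w by (simp add: tensor_space_eq pure_tensor_eq quotient_simps
          F.coset_eq_iff[OF span_submodule])
  qed
qed (use w in \<open>simp_all add: V.vectorspace_axioms VW.vectorspace_axioms pure_tensor_closed\<close>)

lemma pure_tensor_linear_right:
  assumes v: "v \<in> carrier V"
  shows "linear_map K W VW (pt v)"
proof (rule linear_mapI)
  show "pt v (x \<oplus>\<^bsub>W\<^esub> y) = pt v x \<oplus>\<^bsub>VW\<^esub> pt v y" if "x \<in> carrier W" "y \<in> carrier W" for x y
  proof -
    have "e v (x \<oplus>\<^bsub>W\<^esub> y) \<ominus>\<^bsub>F\<^esub> (e v x \<oplus>\<^bsub>F\<^esub> e v y) \<in> N"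
      by (rule relation_in_span) (unfold bilinear_relations_def Let_def, use that v in blast)
    then show ?thesis
      using that v by (simp add: tensor_space_eq pure_tensor_eq quotient_simps
          F.coset_eq_iff[OF span_submodule])
  qed
  show "pt v (c \<odot>\<^bsub>W\<^esub> x) = c \<odot>\<^bsub>VW\<^esub> pt v x" if "c \<in> carrier K" "x \<in> carrier W" for c x
  proof -
    have "e v (c \<odot>\<^bsub>W\<^esub> x) \<ominus>\<^bsub>F\<^esub> (c \<odot>\<^bsub>F\<^esub> e v x) \<in> N"
      by (rule relation_in_span) (unfold bilinear_relations_def Let_def, use that v in blast)
    then show ?thesis
      using that v by (simp add: tensor_space_eq pure_tensor_eq quotient_simps
          F.coset_eq_iff[OF span_submodule])
  qed
qed (use v in \<open>simp_all add: W.vectorspace_axioms VW.vectorspace_axioms pure_tensor_closed\<close>)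

lemma tensor_induct [consumes 1, case_names pure add smult]:
  assumes t: "t \<in> carrier VW"
    and pure: "\<And>v w. v \<in> carrier V \<Longrightarrow> w \<in> carrier W \<Longrightarrow> P (pt v w)"
    and add: "\<And>x y. x \<in> carrier VW \<Longrightarrow> y \<in> carrier VW \<Longrightarrow> P x \<Longrightarrow> P y \<Longrightarrow> P (x \<oplus>\<^bsub>VW\<^esub> y)"
    and smult: "\<And>c x. c \<in> carrier K \<Longrightarrow> x \<in> carrier VW \<Longrightarrow> P x \<Longrightarrow> P (c \<odot>\<^bsub>VW\<^esub> x)"
  shows "P t"
proof -
  obtain f where f: "f \<in> carrier F" "t = N +>\<^bsub>F\<^esub> f"
    using t by (auto simp: tensor_space_eq quotient_simps)
  from f(1) have "P (N +>\<^bsub>F\<^esub> f)"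
  proof (induction f rule: V.free_space_induct)
    case zero
    have "P (\<zero>\<^bsub>K\<^esub> \<odot>\<^bsub>VW\<^esub> pt \<zero>\<^bsub>V\<^esub> \<zero>\<^bsub>W\<^esub>)"
      by (rule smult) (auto intro: pure pure_tensor_closed)
    then show ?case
      by (simp add: pure_tensor_closed) (simp add: tensor_space_eq quotient_simps)
  next
    case (add c s g)
    obtain v w where s: "s = (v, w)" "v \<in> carrier V" "w \<in> carrier W" using add(2) by auto
    have g: "N +>\<^bsub>F\<^esub> g \<in> carrier VW"
      using add(3) by (auto simp: tensor_space_eq quotient_simps)
    have "P (c \<odot>\<^bsub>VW\<^esub> pt v w \<oplus>\<^bsub>VW\<^esub> (N +>\<^bsub>F\<^esub> g))"
      using add s g by (intro assms(3) smult pure) (auto intro: pure_tensor_closed)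
    then show ?case
      using add s by (simp add: tensor_space_eq pure_tensor_eq quotient_simps)
  qed
  with f show ?thesis by simp
qed

lemma linear_eq_on_tensor:
  assumes g: "linear_map K VW U g" and h: "linear_map K VW U h"
    and eq: "\<And>v w. v \<in> carrier V \<Longrightarrow> w \<in> carrier W \<Longrightarrow> g (pt v w) = h (pt v w)"
    and t: "t \<in> carrier VW"
  shows "g t = h t"
  using t by (induction rule: tensor_induct) (simp_all add: eq linear_mapD[OF g] linear_mapD[OF h])

text \<open>The bilinear map extends linearly to the free space on pairs. Bilinearity says exactly that
  the extension kills the bilinearity relations, hence their span, and so it descends to the quotient.\<close>

lemma tensor_lift_exists:
  assumes f: "bilinear K V W U f"
  shows "\<exists>g. linear_map K VW U g \<and> (\<forall>v\<in>carrier V. \<forall>w\<in>carrier W. g (pt v w) = f v w)"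
proof -
  note fl = bilinearD(2)[OF f] and fr = bilinearD(1)[OF f]
  have U: "vectorspace K U" using linear_mapD(2)[OF fl[of "\<zero>\<^bsub>W\<^esub>"]] by simp
  interpret U: vectorspace K U by fact
  define h where "h = (\<lambda>(v, w). f v w)"
  have h: "h \<in> carrier V \<times> carrier W \<rightarrow> carrier U"
    by (auto simp: h_def linear_mapD(3)[OF fl])
  define L where "L = free_lift K (carrier V \<times> carrier W) U h"
  have L: "linear_map K F U L" unfolding L_def by (rule free_lift_linear[OF U h])
  note LD = linear_mapD[OF L]
  have Le: "L (e v w) = f v w" if "v \<in> carrier V" "w \<in> carrier W" for v w
    unfolding L_def using that by (subst free_lift_gen[OF U h]) (auto simp: h_def)
  interpret L: linear_map K F U L by fact
  have "L r = \<zero>\<^bsub>U\<^esub>" if "r \<in> bilinear_relations K V W" for r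
  proof -
    note fc = linear_mapD(3)[OF fl]
    from that consider
        x y w where "x \<in> carrier V" "y \<in> carrier V" "w \<in> carrier W"
          "r = e (x \<oplus>\<^bsub>V\<^esub> y) w \<ominus>\<^bsub>F\<^esub> (e x w \<oplus>\<^bsub>F\<^esub> e y w)"
      | v x y where "v \<in> carrier V" "x \<in> carrier W" "y \<in> carrier W"
          "r = e v (x \<oplus>\<^bsub>W\<^esub> y) \<ominus>\<^bsub>F\<^esub> (e v x \<oplus>\<^bsub>F\<^esub> e v y)"
      | c v w where "c \<in> carrier K" "v \<in> carrier V" "w \<in> carrier W"
          "r = e (c \<odot>\<^bsub>V\<^esub> v) w \<ominus>\<^bsub>F\<^esub> (c \<odot>\<^bsub>F\<^esub> e v w)"
      | c v w where "c \<in> carrier K" "v \<in> carrier V" "w \<in> carrier W"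
          "r = e v (c \<odot>\<^bsub>W\<^esub> w) \<ominus>\<^bsub>F\<^esub> (c \<odot>\<^bsub>F\<^esub> e v w)"
      by (auto simp: bilinear_relations_def Let_def)
    then show ?thesis
      by cases (simp_all add: LD Le fc linear_mapD(4,6)[OF fl] linear_mapD(4,6)[OF fr])
  qed
  then have "bilinear_relations K V W \<subseteq> L.ker"
    using relations_subset by (auto simp: L.ker_def)
  then have "N \<subseteq> L.ker"
    by (rule F.span_is_subset[OF _ L.ker_is_submodule])
  then have "L x = \<zero>\<^bsub>U\<^esub>" if "x \<in> N" for x
    using that by (auto simp: L.ker_def)
  from F.quotient_lift_exists[OF span_submodule L this]
  obtain q where "linear_map K VW U q" "\<And>x. x \<in> carrier F \<Longrightarrow> q (N +>\<^bsub>F\<^esub> x) = L x"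
    by (auto simp: tensor_space_eq)
  then show ?thesis
    by (intro exI[of _ q]) (auto simp: pure_tensor_eq Le)
qed

text \<open>Pure tensors span, which determines the map on the carrier, and outside the carrier it is determined by
  extensionality. Hence the definite description in \<open>tensor_lift\<close> denotes.\<close>

lemma tensor_lift_unique:
  assumes f: "bilinear K V W U f"
  shows "\<exists>!g. g \<in> extensional (carrier VW) \<and> linear_map K VW U g \<and>
    (\<forall>v\<in>carrier V. \<forall>w\<in>carrier W. g (pt v w) = f v w)"
proof -
  from tensor_lift_exists[OF f] obtain g where g: "linear_map K VW U g"
    and gf: "\<forall>v\<in>carrier V. \<forall>w\<in>carrier W. g (pt v w) = f v w" by blast
  have res: "linear_map K VW U (restrict g (carrier VW))"
    by (rule linear_mapI[OF linear_mapD(1,2)[OF g]]) (simp_all add: linear_mapD[OF g])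
  show ?thesis
  proof (rule ex1I)
    show "restrict g (carrier VW) \<in> extensional (carrier VW) \<and>
        linear_map K VW U (restrict g (carrier VW)) \<and>
        (\<forall>v\<in>carrier V. \<forall>w\<in>carrier W. restrict g (carrier VW) (pt v w) = f v w)"
      using gf res by (auto simp: pure_tensor_closed)
    show "h = restrict g (carrier VW)"
      if h: "h \<in> extensional (carrier VW) \<and> linear_map K VW U h \<and>
        (\<forall>v\<in>carrier V. \<forall>w\<in>carrier W. h (pt v w) = f v w)" for h
    proof (rule extensionalityI[of _ "carrier VW"])
      show "h t = restrict g (carrier VW) t" if "t \<in> carrier VW" for t
        using linear_eq_on_tensor[of U h g t] g gf h that by simp
    qed (use h in auto)
  qed
qed

end

context
  fixes K V W assumes V: "vectorspace K V" and W: "vectorspace K W"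
begin

interpretation vectorspace_pair K V W
  by (intro vectorspace_pair.intro V W)

lemma vectorspace_tensor_space: "vectorspace K (tensor_space K V W)"
  by (rule tensor_vectorspace)

lemma pure_tensor_bilinear: "bilinear K V W (tensor_space K V W) (pure_tensor K V W)"
  by (intro bilinearI pure_tensor_linear_left pure_tensor_linear_right)

end

context
  fixes K V W U f assumes V: "vectorspace K V" and W: "vectorspace K W"
    and f: "bilinear K V W U f"
begin

interpretation vectorspace_pair K V W
  by (intro vectorspace_pair.intro V W)

lemma tensor_lift_linear: "linear_map K (tensor_space K V W) U (tensor_lift K V W U f)"
  using theI'[OF tensor_lift_unique[OF f]] by (simp add: tensor_lift_def)

lemma tensor_lift_pure:
  "v \<in> carrier V \<Longrightarrow> w \<in> carrier W \<Longrightarrow> tensor_lift K V W U f (pure_tensor K V W v w) = f v w"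
  using theI'[OF tensor_lift_unique[OF f]] by (simp add: tensor_lift_def)

end

text \<open>The characterisation of \<open>tensor_lift\<close> mentions \<open>f\<close> on the carriers only. As a congruence rule this
  lets the simplifier rewrite below a lift knowing that the bound variables lie in the carriers.\<close>

lemma tensor_lift_cong [cong]:
  assumes "\<And>v w. v \<in> carrier V \<Longrightarrow> w \<in> carrier W \<Longrightarrow> f v w = g v w"
  shows "tensor_lift K V W U f = tensor_lift K V W U g"
  unfolding tensor_lift_def by (simp add: assms)

text \<open>This is the passage to Sweedler notation: it expands the value of a linear map at an arbitrary tensor through its
  values on pure tensors.\<close>

lemma linear_map_tensor_lift:
  assumes V: "vectorspace K V" and W: "vectorspace K W"
    and L: "linear_map K (tensor_space K V W) U L" and t: "t \<in> carrier (tensor_space K V W)"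
  shows "L t = tensor_lift K V W U (\<lambda>v w. L (pure_tensor K V W v w)) t"
proof -
  interpret vectorspace_pair K V W by (intro vectorspace_pair.intro V W)
  have "bilinear K V W U (\<lambda>v w. L (pure_tensor K V W v w))"
    by (intro bilinearI linear_mapI linear_mapD(2)[OF L] V W)
      (simp_all add: linear_mapD[OF L] pure_tensor_closed linear_mapD[OF pure_tensor_linear_left] linear_mapD[OF pure_tensor_linear_right])
  note lift = tensor_lift_linear[OF V W this] tensor_lift_pure[OF V W this]
  show ?thesis
    by (rule linear_eq_on_tensor[OF L lift(1) _ t]) (simp add: lift(2))
qed

section \<open>Closure properties of linear and bilinear maps\<close>

lemma linear_map_id: "vectorspace K V \<Longrightarrow> linear_map K V V (\<lambda>x. x)"
  by (rule linear_mapI) auto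

lemma linear_map_comp:
  assumes g: "linear_map K W U g" and f: "linear_map K V W f"
  shows "linear_map K V U (\<lambda>x. g (f x))"
  by (rule linear_mapI[OF linear_mapD(1)[OF f] linear_mapD(2)[OF g]])
    (simp_all add: linear_mapD[OF f] linear_mapD[OF g])

lemma linear_map_plus:
  assumes f: "linear_map K V W f" and g: "linear_map K V W g"
  shows "linear_map K V W (\<lambda>x. f x \<oplus>\<^bsub>W\<^esub> g x)"
proof -
  interpret W: vectorspace K W by (rule linear_mapD(2)[OF f])
  show ?thesis
    by (rule linear_mapI[OF linear_mapD(1,2)[OF f]])
      (simp_all add: linear_mapD[OF f] linear_mapD[OF g] W.smult_r_distr W.M.a_ac)
qed

lemma linear_map_scale:
  assumes f: "linear_map K V W f" and k: "k \<in> carrier K"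
  shows "linear_map K V W (\<lambda>x. k \<odot>\<^bsub>W\<^esub> f x)"
proof -
  interpret W: vectorspace K W by (rule linear_mapD(2)[OF f])
  have "k \<odot>\<^bsub>W\<^esub> (c \<odot>\<^bsub>W\<^esub> y) = c \<odot>\<^bsub>W\<^esub> (k \<odot>\<^bsub>W\<^esub> y)" if "c \<in> carrier K" "y \<in> carrier W" for c y
    using that k by (simp add: W.R.m_comm flip: W.smult_assoc1)
  then show ?thesis
    by (intro linear_mapI[OF linear_mapD(1,2)[OF f]])
      (simp_all add: linear_mapD[OF f] W.smult_r_distr k)
qed

lemma linear_map_diff:
  assumes f: "linear_map K V W f" and g: "linear_map K V W g"
  shows "linear_map K V W (\<lambda>x. f x \<ominus>\<^bsub>W\<^esub> g x)"
proof -
  interpret W: vectorspace K W by (rule linear_mapD(2)[OF f])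
  show ?thesis
    by (rule linear_mapI[OF linear_mapD(1,2)[OF f]])
      (simp_all add: linear_mapD[OF f] linear_mapD[OF g] W.smult_r_distr W.smult_r_minus
        W.M.minus_add W.M.a_ac a_minus_def)
qed

lemma bilinear_plus:
  "bilinear K V W U f \<Longrightarrow> bilinear K V W U g \<Longrightarrow> bilinear K V W U (\<lambda>x y. f x y \<oplus>\<^bsub>U\<^esub> g x y)"
  by (simp add: bilinear_def linear_map_plus)

lemma bilinear_diff:
  "bilinear K V W U f \<Longrightarrow> bilinear K V W U g \<Longrightarrow> bilinear K V W U (\<lambda>x y. f x y \<ominus>\<^bsub>U\<^esub> g x y)"
  by (simp add: bilinear_def linear_map_diff)

lemma bilinear_scale:
  "bilinear K V W U f \<Longrightarrow> k \<in> carrier K \<Longrightarrow> bilinear K V W U (\<lambda>x y. k \<odot>\<^bsub>U\<^esub> f x y)"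
  by (simp add: bilinear_def linear_map_scale)

lemma bilinear_comp:
  "linear_map K U U' L \<Longrightarrow> bilinear K V W U f \<Longrightarrow> bilinear K V W U' (\<lambda>x y. L (f x y))"
  by (simp add: bilinear_def linear_map_comp[of K U U' L])

lemma bilinear_comp2:
  assumes f: "bilinear K V' W' U f" and g: "linear_map K V V' g" and h: "linear_map K W W' h"
  shows "bilinear K V W U (\<lambda>x y. f (g x) (h y))"
  by (intro bilinearI linear_map_comp[OF bilinearD(1)[OF f] h] linear_map_comp[OF bilinearD(2)[OF f] g])
    (simp_all add: linear_mapD[OF g] linear_mapD[OF h])

lemma bilinear_closed:
  "bilinear K V W U f \<Longrightarrow> v \<in> carrier V \<Longrightarrow> w \<in> carrier W \<Longrightarrow> f v w \<in> carrier U"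
  by (meson bilinearD(1) linear_mapD(3))

context
  fixes K V W assumes V: "vectorspace K V" and W: "vectorspace K W"
begin

interpretation vectorspace_pair K V W
  by (intro vectorspace_pair.intro V W)

lemmas lift_linear = tensor_lift_linear[OF V W]
lemmas lift_pure = tensor_lift_pure[OF V W]

lemma linear_map_tensor_lift_comp:
  assumes L: "linear_map K U U' L" and f: "bilinear K V W U f"
    and t: "t \<in> carrier (tensor_space K V W)"
  shows "L (tensor_lift K V W U f t) = tensor_lift K V W U' (\<lambda>x y. L (f x y)) t"
  by (rule linear_eq_on_tensor[OF linear_map_comp[OF L lift_linear[OF f]]
        lift_linear[OF bilinear_comp[OF L f]] _ t])
    (simp add: lift_pure[OF f] lift_pure[OF bilinear_comp[OF L f]])

lemma tensor_lift_plus: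
  assumes f: "bilinear K V W U f" and g: "bilinear K V W U g"
    and t: "t \<in> carrier (tensor_space K V W)"
  shows "tensor_lift K V W U (\<lambda>x y. f x y \<oplus>\<^bsub>U\<^esub> g x y) t =
    tensor_lift K V W U f t \<oplus>\<^bsub>U\<^esub> tensor_lift K V W U g t"
  by (rule linear_eq_on_tensor[OF lift_linear[OF bilinear_plus[OF f g]]
        linear_map_plus[OF lift_linear[OF f] lift_linear[OF g]] _ t])
    (simp add: lift_pure[OF f] lift_pure[OF g] lift_pure[OF bilinear_plus[OF f g]])

lemma tensor_lift_diff:
  assumes f: "bilinear K V W U f" and g: "bilinear K V W U g"
    and t: "t \<in> carrier (tensor_space K V W)"
  shows "tensor_lift K V W U (\<lambda>x y. f x y \<ominus>\<^bsub>U\<^esub> g x y) t =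
    tensor_lift K V W U f t \<ominus>\<^bsub>U\<^esub> tensor_lift K V W U g t"
  by (rule linear_eq_on_tensor[OF lift_linear[OF bilinear_diff[OF f g]]
        linear_map_diff[OF lift_linear[OF f] lift_linear[OF g]] _ t])
    (simp add: lift_pure[OF f] lift_pure[OF g] lift_pure[OF bilinear_diff[OF f g]])

lemma tensor_lift_scale:
  assumes f: "bilinear K V W U f" and k: "k \<in> carrier K"
    and t: "t \<in> carrier (tensor_space K V W)"
  shows "tensor_lift K V W U (\<lambda>x y. k \<odot>\<^bsub>U\<^esub> f x y) t = k \<odot>\<^bsub>U\<^esub> tensor_lift K V W U f t"
  by (rule linear_eq_on_tensor[OF lift_linear[OF bilinear_scale[OF f k]]
        linear_map_scale[OF lift_linear[OF f] k] _ t])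
    (simp add: lift_pure[OF f] lift_pure[OF bilinear_scale[OF f k]])

text \<open>Nested Sweedler sums need this: in \<open>f(c\<^sub>1, c\<^sub>2\<^sub>1, c\<^sub>2\<^sub>2)\<close> the inner sum must depend linearly on
  \<open>c\<^sub>1\<close> for the outer sum to make sense.\<close>

lemma tensor_lift_linear_parameter:
  assumes X: "vectorspace K X" and U: "vectorspace K U"
    and h: "\<And>x. x \<in> carrier X \<Longrightarrow> bilinear K V W U (h x)"
    and lin: "\<And>v w. v \<in> carrier V \<Longrightarrow> w \<in> carrier W \<Longrightarrow> linear_map K X U (\<lambda>x. h x v w)"
    and t: "t \<in> carrier (tensor_space K V W)"
  shows "linear_map K X U (\<lambda>x. tensor_lift K V W U (h x) t)"
proof (rule linear_mapI[OF X U])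
  fix x y assume x: "x \<in> carrier X" and y: "y \<in> carrier X"
  show "tensor_lift K V W U (h x) t \<in> carrier U"
    by (rule linear_mapD(3)[OF lift_linear[OF h[OF x]] t])
  have "tensor_lift K V W U (h (x \<oplus>\<^bsub>X\<^esub> y)) = tensor_lift K V W U (\<lambda>v w. h x v w \<oplus>\<^bsub>U\<^esub> h y v w)"
    by (rule tensor_lift_cong) (rule linear_mapD(4)[OF lin x y])
  then show "tensor_lift K V W U (h (x \<oplus>\<^bsub>X\<^esub> y)) t =
      tensor_lift K V W U (h x) t \<oplus>\<^bsub>U\<^esub> tensor_lift K V W U (h y) t"
    by (simp add: tensor_lift_plus[OF h[OF x] h[OF y] t])
next
  fix c x assume c: "c \<in> carrier K" and x: "x \<in> carrier X"
  have "tensor_lift K V W U (h (c \<odot>\<^bsub>X\<^esub> x)) = tensor_lift K V W U (\<lambda>v w. c \<odot>\<^bsub>U\<^esub> h x v w)"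
    by (rule tensor_lift_cong) (rule linear_mapD(6)[OF lin c x])
  then show "tensor_lift K V W U (h (c \<odot>\<^bsub>X\<^esub> x)) t = c \<odot>\<^bsub>U\<^esub> tensor_lift K V W U (h x) t"
    by (simp add: tensor_lift_scale[OF h[OF x] c t])
qed

end

section \<open>The structural maps of tensor products\<close>

lemma
  assumes f: "linear_map K V V' f" and g: "linear_map K W W' g"
  shows tensor_map_linear:
      "linear_map K (tensor_space K V W) (tensor_space K V' W') (tensor_map K V W V' W' f g)"
    and tensor_map_pure: "v \<in> carrier V \<Longrightarrow> w \<in> carrier W \<Longrightarrow>
      tensor_map K V W V' W' f g (pure_tensor K V W v w) = pure_tensor K V' W' (f v) (g w)"
proof -
  note V = linear_mapD(1)[OF f] linear_mapD(1)[OF g]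
  have b: "bilinear K V W (tensor_space K V' W') (\<lambda>v w. pure_tensor K V' W' (f v) (g w))"
    by (rule bilinear_comp2[OF pure_tensor_bilinear f g]) (rule linear_mapD(2)[OF f] linear_mapD(2)[OF g])+
  show "linear_map K (tensor_space K V W) (tensor_space K V' W') (tensor_map K V W V' W' f g)"
    unfolding tensor_map_def by (rule tensor_lift_linear[OF V b])
  show "tensor_map K V W V' W' f g (pure_tensor K V W v w) = pure_tensor K V' W' (f v) (g w)"
    if "v \<in> carrier V" "w \<in> carrier W"
    unfolding tensor_map_def by (rule tensor_lift_pure[OF V b that])
qed

lemma
  assumes V: "vectorspace K V" and W: "vectorspace K W"
  shows tensor_flip_linear:
      "linear_map K (tensor_space K V W) (tensor_space K W V) (tensor_flip K V W)"
    and tensor_flip_pure: "v \<in> carrier V \<Longrightarrow> w \<in> carrier W \<Longrightarrow>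
      tensor_flip K V W (pure_tensor K V W v w) = pure_tensor K W V w v"
proof -
  have b: "bilinear K V W (tensor_space K W V) (\<lambda>v w. pure_tensor K W V w v)"
    using pure_tensor_bilinear[OF W V] by (simp add: bilinear_def)
  show "linear_map K (tensor_space K V W) (tensor_space K W V) (tensor_flip K V W)"
    unfolding tensor_flip_def by (rule tensor_lift_linear[OF V W b])
  show "tensor_flip K V W (pure_tensor K V W v w) = pure_tensor K W V w v"
    if "v \<in> carrier V" "w \<in> carrier W"
    unfolding tensor_flip_def by (rule tensor_lift_pure[OF V W b that])
qed

text \<open>A trilinear map out of \<open>U \<times> V \<times> W\<close> extends along either bracketing of the triple
  tensor product.\<close>

definition trilinear where
  "trilinear K U V W X h \<longleftrightarrow> (\<forall>u\<in>carrier U. bilinear K V W X (h u)) \<and>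
    (\<forall>v\<in>carrier V. \<forall>w\<in>carrier W. linear_map K U X (\<lambda>u. h u v w))"

lemma trilinearI:
  assumes "\<And>v w. v \<in> carrier V \<Longrightarrow> w \<in> carrier W \<Longrightarrow> linear_map K U X (\<lambda>u. h u v w)"
    and "\<And>u w. u \<in> carrier U \<Longrightarrow> w \<in> carrier W \<Longrightarrow> linear_map K V X (\<lambda>v. h u v w)"
    and "\<And>u v. u \<in> carrier U \<Longrightarrow> v \<in> carrier V \<Longrightarrow> linear_map K W X (\<lambda>w. h u v w)"
  shows "trilinear K U V W X h"
  using assms by (simp add: trilinear_def bilinear_def)

lemma trilinearD:
  assumes "trilinear K U V W X h"
  shows "u \<in> carrier U \<Longrightarrow> bilinear K V W X (h u)"
    and "w \<in> carrier W \<Longrightarrow> bilinear K U V X (\<lambda>u v. h u v w)"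
    and "v \<in> carrier V \<Longrightarrow> w \<in> carrier W \<Longrightarrow> linear_map K U X (\<lambda>u. h u v w)"
    and "u \<in> carrier U \<Longrightarrow> w \<in> carrier W \<Longrightarrow> linear_map K V X (\<lambda>v. h u v w)"
    and "u \<in> carrier U \<Longrightarrow> v \<in> carrier V \<Longrightarrow> linear_map K W X (h u v)"
  using assms by (simp_all add: trilinear_def bilinear_def)

context
  fixes K U V W
  assumes U: "vectorspace K U" and V: "vectorspace K V" and W: "vectorspace K W"
begin

lemmas tensor_left_vs = vectorspace_tensor_space[OF U V] and tensor_right_vs = vectorspace_tensor_space[OF V W]

lemma trilinear_lift_right:
  assumes X: "vectorspace K X" and h: "trilinear K U V W X h"
  shows "bilinear K U (tensor_space K V W) X (\<lambda>u t. tensor_lift K V W X (h u) t)"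
  by (intro bilinearI tensor_lift_linear[OF V W] tensor_lift_linear_parameter[OF V W U X] trilinearD[OF h])

lemma trilinear_lift_left:
  assumes X: "vectorspace K X" and h: "trilinear K U V W X h"
  shows "bilinear K (tensor_space K U V) W X (\<lambda>t w. tensor_lift K U V X (\<lambda>u v. h u v w) t)"
  by (intro bilinearI tensor_lift_linear[OF U V] tensor_lift_linear_parameter[OF U V W X] trilinearD[OF h])

lemma trilinear_pure_right:
  "trilinear K U V W (tensor_space K U (tensor_space K V W))
     (\<lambda>u v w. pure_tensor K U (tensor_space K V W) u (pure_tensor K V W v w))"
proof -
  note b = pure_tensor_bilinear[OF U tensor_right_vs] pure_tensor_bilinear[OF V W]
  show ?thesis
    by (intro trilinearI bilinearD(2)[OF b(1)] linear_map_comp[OF bilinearD(1)[OF b(1)]]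
        bilinearD[OF b(2)]) (simp_all add: bilinear_closed[OF b(2)])
qed

lemma trilinear_pure_left:
  "trilinear K U V W (tensor_space K (tensor_space K U V) W)
     (\<lambda>u v w. pure_tensor K (tensor_space K U V) W (pure_tensor K U V u v) w)"
proof -
  note b = pure_tensor_bilinear[OF tensor_left_vs W] pure_tensor_bilinear[OF U V]
  show ?thesis
    by (intro trilinearI bilinearD(1)[OF b(1)] linear_map_comp[OF bilinearD(2)[OF b(1)]]
        bilinearD[OF b(2)]) (simp_all add: bilinear_closed[OF b(2)])
qed

lemma tensor_assoc_linear:
  "linear_map K (tensor_space K (tensor_space K U V) W) (tensor_space K U (tensor_space K V W))
     (tensor_assoc K U V W)"
  unfolding tensor_assoc_def Let_def
  by (rule tensor_lift_linear[OF tensor_left_vs W trilinear_lift_left[OF vectorspace_tensor_space[OF U tensor_right_vs] trilinear_pure_right]])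

text \<open>The Hom-coassociativity axiom applies the associator to \<open>\<Delta>(c\<^sub>1) \<otimes> \<alpha>(c\<^sub>2)\<close>, whose left factor is
  a general tensor.\<close>

lemma tensor_assoc_pure:
  assumes "t \<in> carrier (tensor_space K U V)" "w \<in> carrier W"
  shows "tensor_assoc K U V W (pure_tensor K (tensor_space K U V) W t w) =
    tensor_lift K U V (tensor_space K U (tensor_space K V W))
      (\<lambda>u v. pure_tensor K U (tensor_space K V W) u (pure_tensor K V W v w)) t"
  unfolding tensor_assoc_def Let_def
  by (rule tensor_lift_pure[OF tensor_left_vs W trilinear_lift_left[OF vectorspace_tensor_space[OF U tensor_right_vs] trilinear_pure_right] assms])

lemma tensor_assoc_pure_pure:
  assumes "u \<in> carrier U" "v \<in> carrier V" "w \<in> carrier W"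
  shows "tensor_assoc K U V W (pure_tensor K (tensor_space K U V) W (pure_tensor K U V u v) w) =
    pure_tensor K U (tensor_space K V W) u (pure_tensor K V W v w)"
  using assms tensor_lift_pure[OF U V trilinearD(2)[OF trilinear_pure_right]]
  by (simp add: tensor_assoc_pure bilinear_closed[OF pure_tensor_bilinear[OF U V]])

lemma tensor_assoc_inv_linear:
  "linear_map K (tensor_space K U (tensor_space K V W)) (tensor_space K (tensor_space K U V) W)
     (tensor_assoc_inv K U V W)"
  unfolding tensor_assoc_inv_def Let_def
  by (rule tensor_lift_linear[OF U tensor_right_vs trilinear_lift_right[OF vectorspace_tensor_space[OF tensor_left_vs W] trilinear_pure_left]])

lemma tensor_assoc_inv_pure_pure:
  assumes "u \<in> carrier U" "v \<in> carrier V" "w \<in> carrier W"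
  shows "tensor_assoc_inv K U V W (pure_tensor K U (tensor_space K V W) u (pure_tensor K V W v w)) =
    pure_tensor K (tensor_space K U V) W (pure_tensor K U V u v) w"
  unfolding tensor_assoc_inv_def Let_def
  using assms tensor_lift_pure[OF V W trilinearD(1)[OF trilinear_pure_left]]
  by (subst tensor_lift_pure[OF U tensor_right_vs trilinear_lift_right[OF vectorspace_tensor_space[OF tensor_left_vs W] trilinear_pure_left]])
    (simp_all add: bilinear_closed[OF pure_tensor_bilinear[OF V W]])

text \<open>By this lemma the vanishing of a commutator needs to be checked on pure tensors only.\<close>

lemma linear_eq_on_triple_tensor:
  assumes g: "linear_map K (tensor_space K (tensor_space K U V) W) X g"
    and h: "linear_map K (tensor_space K (tensor_space K U V) W) X h"
    and eq: "\<And>u v w. u \<in> carrier U \<Longrightarrow> v \<in> carrier V \<Longrightarrow> w \<in> carrier W \<Longrightarrow>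
      g (pure_tensor K (tensor_space K U V) W (pure_tensor K U V u v) w) =
      h (pure_tensor K (tensor_space K U V) W (pure_tensor K U V u v) w)"
    and x: "x \<in> carrier (tensor_space K (tensor_space K U V) W)"
  shows "g x = h x"
proof -
  interpret P: vectorspace_pair K U V by (intro vectorspace_pair.intro U V)
  interpret Q: vectorspace_pair K "tensor_space K U V" W by (intro vectorspace_pair.intro tensor_left_vs W)
  show ?thesis
  proof (rule Q.linear_eq_on_tensor[OF g h _ x])
    fix t w assume t: "t \<in> carrier (tensor_space K U V)" and w: "w \<in> carrier W"
    show "g (Q.pt t w) = h (Q.pt t w)"
      by (rule P.linear_eq_on_tensor[OF linear_map_comp[OF g Q.pure_tensor_linear_left[OF w]]
            linear_map_comp[OF h Q.pure_tensor_linear_left[OF w]] eq t]) (use w in auto)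
  qed
qed

end

section \<open>Sweedler calculus in a Hom-coalgebra\<close>

context hom_coalgebra
begin

abbreviation "CC \<equiv> tensor_space K C C"
abbreviation "CCC \<equiv> tensor_space K CC C"

definition tri where "tri x y z = pure_tensor K CC C (pure_tensor K C C x y) z"

text \<open>This is \<open>f(c\<^sub>1, c\<^sub>2)\<close> in Sweedler notation. The target is always the threefold tensor power, on which
  the commutators live.\<close>

abbreviation "sw f c \<equiv> tensor_lift K C C CCC f (\<Delta> c)"

abbreviation "lin \<equiv> linear_map K C CCC"
abbreviation "bil \<equiv> bilinear K C C CCC"

lemma C_vs: "vectorspace K C" by unfold_locales

lemmas CC_vs = vectorspace_tensor_space[OF C_vs C_vs]
lemmas CCC_vs = vectorspace_tensor_space[OF CC_vs C_vs]

sublocale CCC: vectorspace K CCC by (rule CCC_vs)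

lemma comult_closed [simp]: "c \<in> carrier C \<Longrightarrow> \<Delta> c \<in> carrier CC"
  by (rule linear_mapD(3)[OF comult_linear])

lemma counit_closed [simp]: "c \<in> carrier C \<Longrightarrow> \<epsilon> c \<in> carrier K"
  using linear_mapD(3)[OF counit_linear] by (simp add: scalar_space_def)

lemma twist_closed [simp]: "c \<in> carrier C \<Longrightarrow> \<alpha> c \<in> carrier C"
  by (rule linear_mapD(3)[OF twist_linear])

lemma trilinear_tri: "trilinear K C C C CCC tri"
  unfolding tri_def by (rule trilinear_pure_left[OF C_vs C_vs C_vs])

lemma tri_closed [simp]:
  "x \<in> carrier C \<Longrightarrow> y \<in> carrier C \<Longrightarrow> z \<in> carrier C \<Longrightarrow> tri x y z \<in> carrier CCC"
  by (rule linear_mapD(3)[OF trilinearD(3)[OF trilinear_tri]])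

text \<open>The rules below decide, by the shape of a term, whether it is linear in a variable. As
  simplification rules they discharge the (bi)linearity conditions of the Sweedler calculus; twist, counit
  and coproduct occur with an arbitrary linear argument so that iterates of \<open>\<alpha>\<close> are covered.\<close>

lemma lin_id [simp]: "linear_map K C C (\<lambda>x. x)"
  by (rule linear_map_id[OF C_vs])

lemma lin_twist [simp]: "linear_map K C C f \<Longrightarrow> linear_map K C C (\<lambda>x. \<alpha> (f x))"
  by (rule linear_map_comp[OF twist_linear])

lemma lin_tri [simp]:
  "linear_map K C C f \<Longrightarrow> y \<in> carrier C \<Longrightarrow> z \<in> carrier C \<Longrightarrow> lin (\<lambda>x. tri (f x) y z)"
  "linear_map K C C f \<Longrightarrow> x \<in> carrier C \<Longrightarrow> z \<in> carrier C \<Longrightarrow> lin (\<lambda>y. tri x (f y) z)"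
  "linear_map K C C f \<Longrightarrow> x \<in> carrier C \<Longrightarrow> y \<in> carrier C \<Longrightarrow> lin (\<lambda>z. tri x y (f z))"
  by (rule linear_map_comp[OF trilinearD(3)[OF trilinear_tri]]
      linear_map_comp[OF trilinearD(4)[OF trilinear_tri]]
      linear_map_comp[OF trilinearD(5)[OF trilinear_tri]]; assumption)+

lemma lin_counit [simp]:
  assumes "linear_map K C C f" "t \<in> carrier CCC"
  shows "lin (\<lambda>x. \<epsilon> (f x) \<odot>\<^bsub>CCC\<^esub> t)"
proof -
  note \<epsilon> = linear_mapD[OF linear_map_comp[OF counit_linear assms(1)], unfolded scalar_space_def, simplified]
  show ?thesis
    by (rule linear_mapI[OF C_vs CCC_vs])
      (simp_all add: \<epsilon> assms(2) CCC.smult_l_distr CCC.smult_assoc1)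
qed

lemma lin_scale [simp]: "lin f \<Longrightarrow> k \<in> carrier K \<Longrightarrow> lin (\<lambda>x. k \<odot>\<^bsub>CCC\<^esub> f x)"
  by (rule linear_map_scale)

lemma lin_plus [simp]: "lin f \<Longrightarrow> lin g \<Longrightarrow> lin (\<lambda>x. f x \<oplus>\<^bsub>CCC\<^esub> g x)"
  by (rule linear_map_plus)

lemma lin_diff [simp]: "lin f \<Longrightarrow> lin g \<Longrightarrow> lin (\<lambda>x. f x \<ominus>\<^bsub>CCC\<^esub> g x)"
  by (rule linear_map_diff)

lemma sw_cong: "(\<And>x y. x \<in> carrier C \<Longrightarrow> y \<in> carrier C \<Longrightarrow> f x y = g x y) \<Longrightarrow> sw f c = sw g c"
  by (simp cong: tensor_lift_cong)

lemma lin_sw [simp]: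
  assumes "bil h" "linear_map K C C f"
  shows "lin (\<lambda>c. sw h (f c))"
  by (rule linear_map_comp[OF tensor_lift_linear[OF C_vs C_vs assms(1)] linear_map_comp[OF comult_linear assms(2)]])

lemma lin_sw_param [simp]:
  assumes "\<And>x. x \<in> carrier C \<Longrightarrow> bil (h x)"
    and "\<And>u v. u \<in> carrier C \<Longrightarrow> v \<in> carrier C \<Longrightarrow> lin (\<lambda>x. h x u v)"
    and "c \<in> carrier C"
  shows "lin (\<lambda>x. sw (h x) c)"
  by (rule tensor_lift_linear_parameter[OF C_vs C_vs C_vs CCC_vs assms(1,2)]) (simp_all add: assms(3))

lemma bil_iff: "bil h \<longleftrightarrow> (\<forall>x\<in>carrier C. lin (h x)) \<and> (\<forall>y\<in>carrier C. lin (\<lambda>x. h x y))"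
  by (simp add: bilinear_def)

lemma sw_closed [simp]: "bil h \<Longrightarrow> c \<in> carrier C \<Longrightarrow> sw h c \<in> carrier CCC"
  by (rule linear_mapD(3)[OF tensor_lift_linear[OF C_vs C_vs]]) simp_all

lemma sw_plus: "bil f \<Longrightarrow> bil g \<Longrightarrow> c \<in> carrier C \<Longrightarrow>
    sw (\<lambda>x y. f x y \<oplus>\<^bsub>CCC\<^esub> g x y) c = sw f c \<oplus>\<^bsub>CCC\<^esub> sw g c"
  by (rule tensor_lift_plus[OF C_vs C_vs]) simp_all

lemma sw_diff: "bil f \<Longrightarrow> bil g \<Longrightarrow> c \<in> carrier C \<Longrightarrow>
    sw (\<lambda>x y. f x y \<ominus>\<^bsub>CCC\<^esub> g x y) c = sw f c \<ominus>\<^bsub>CCC\<^esub> sw g c"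
  by (rule tensor_lift_diff[OF C_vs C_vs]) simp_all

lemma sw_scale: "bil f \<Longrightarrow> k \<in> carrier K \<Longrightarrow> c \<in> carrier C \<Longrightarrow>
    sw (\<lambda>x y. k \<odot>\<^bsub>CCC\<^esub> f x y) c = k \<odot>\<^bsub>CCC\<^esub> sw f c"
  by (rule tensor_lift_scale[OF C_vs C_vs]) simp_all

lemma linear_sw: "linear_map K CCC CCC L \<Longrightarrow> bil f \<Longrightarrow> c \<in> carrier C \<Longrightarrow>
    L (sw f c) = sw (\<lambda>x y. L (f x y)) c"
  by (rule linear_map_tensor_lift_comp[OF C_vs C_vs]) simp_all

text \<open>The map \<open>g\<close> carries the axiom \<open>\<epsilon>(c\<^sub>1) c\<^sub>2 = \<alpha>(c)\<close> from \<open>C\<close> to the threefold tensor power.\<close>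

lemma sw_counit_left:
  assumes g: "lin g" and c: "c \<in> carrier C"
  shows "sw (\<lambda>x y. \<epsilon> x \<odot>\<^bsub>CCC\<^esub> g y) c = g (\<alpha> c)"
proof -
  note gD = linear_mapD[OF g]
  note \<epsilon> = linear_mapD[OF counit_linear, unfolded scalar_space_def, simplified]
  have b: "bilinear K C C C (\<lambda>x y. \<epsilon> x \<odot>\<^bsub>C\<^esub> y)"
    by (intro bilinearI linear_mapI C_vs)
      (simp_all add: \<epsilon> smult_l_distr smult_r_distr smult_assoc1 R.m_comm flip: smult_assoc1)
  have "g (\<alpha> c) = g (tensor_lift K C C C (\<lambda>x y. \<epsilon> x \<odot>\<^bsub>C\<^esub> y) (\<Delta> c))"
    by (simp add: hom_counit_left c)
  also have "\<dots> = sw (\<lambda>x y. g (\<epsilon> x \<odot>\<^bsub>C\<^esub> y)) c"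
    by (rule linear_map_tensor_lift_comp[OF C_vs C_vs g b]) (simp add: c)
  also have "\<dots> = sw (\<lambda>x y. \<epsilon> x \<odot>\<^bsub>CCC\<^esub> g y) c"
    by (rule sw_cong) (simp add: gD)
  finally show ?thesis by simp
qed

lemma sw_counit_right:
  assumes g: "lin g" and c: "c \<in> carrier C"
  shows "sw (\<lambda>x y. \<epsilon> y \<odot>\<^bsub>CCC\<^esub> g x) c = g (\<alpha> c)"
proof -
  note gD = linear_mapD[OF g]
  note \<epsilon> = linear_mapD[OF counit_linear, unfolded scalar_space_def, simplified]
  have b: "bilinear K C C C (\<lambda>x y. \<epsilon> y \<odot>\<^bsub>C\<^esub> x)"
    by (intro bilinearI linear_mapI C_vs)
      (simp_all add: \<epsilon> smult_l_distr smult_r_distr smult_assoc1 R.m_comm flip: smult_assoc1)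
  have "g (\<alpha> c) = g (tensor_lift K C C C (\<lambda>x y. \<epsilon> y \<odot>\<^bsub>C\<^esub> x) (\<Delta> c))"
    by (simp add: hom_counit_right c)
  also have "\<dots> = sw (\<lambda>x y. g (\<epsilon> y \<odot>\<^bsub>C\<^esub> x)) c"
    by (rule linear_map_tensor_lift_comp[OF C_vs C_vs g b]) (simp add: c)
  also have "\<dots> = sw (\<lambda>x y. \<epsilon> y \<odot>\<^bsub>CCC\<^esub> g x) c"
    by (rule sw_cong) (simp add: gD)
  finally show ?thesis by simp
qed

text \<open>Comultiplicativity of \<open>\<alpha>\<close>, with the lift of \<open>f\<close> applied to both sides.\<close>

lemma sw_twist:
  assumes f: "bil f" and c: "c \<in> carrier C"
  shows "sw f (\<alpha> c) = sw (\<lambda>x y. f (\<alpha> x) (\<alpha> y)) c"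
proof -
  have b: "bilinear K C C CC (\<lambda>x y. pure_tensor K C C (\<alpha> x) (\<alpha> y))"
    by (rule bilinear_comp2[OF pure_tensor_bilinear[OF C_vs C_vs] twist_linear twist_linear])
  have "sw f (\<alpha> c) = tensor_lift K C C CCC f (tensor_lift K C C CC (\<lambda>x y. pure_tensor K C C (\<alpha> x) (\<alpha> y)) (\<Delta> c))"
    by (simp only: comult_twist[OF c] tensor_map_def)
  also have "\<dots> = sw (\<lambda>x y. tensor_lift K C C CCC f (pure_tensor K C C (\<alpha> x) (\<alpha> y))) c"
    by (rule linear_map_tensor_lift_comp[OF C_vs C_vs tensor_lift_linear[OF C_vs C_vs f] b]) (simp add: c)
  also have "\<dots> = sw (\<lambda>x y. f (\<alpha> x) (\<alpha> y)) c"
    by (rule sw_cong) (simp add: tensor_lift_pure[OF C_vs C_vs f])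
  finally show ?thesis .
qed

text \<open>The trilinear map \<open>h\<close> extends to a linear map \<open>H\<close> on \<open>C \<otimes> (C \<otimes> C)\<close>. Applying \<open>H\<close> to the two sides of the
  Hom-coassociativity axiom, the right one after reassociating, gives the two nested Sweedler sums.\<close>

lemma sw_coassoc:
  assumes h: "trilinear K C C C CCC h" and c: "c \<in> carrier C"
  shows "sw (\<lambda>x y. sw (\<lambda>u v. h (\<alpha> x) u v) y) c = sw (\<lambda>x y. sw (\<lambda>u v. h u v (\<alpha> y)) x) c"
proof -
  note vs = C_vs CC_vs
  let ?C_CC = "tensor_space K C CC"
  define H where "H = tensor_lift K C CC CCC (\<lambda>x t. tensor_lift K C C CCC (h x) t)"
  note b = trilinear_lift_right[OF C_vs C_vs C_vs CCC_vs h]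
  have H: "linear_map K ?C_CC CCC H"
    unfolding H_def by (rule tensor_lift_linear[OF vs b])
  have H_pure: "H (pure_tensor K C CC x t) = tensor_lift K C C CCC (h x) t"
    if "x \<in> carrier C" "t \<in> carrier CC" for x t
    unfolding H_def by (rule tensor_lift_pure[OF vs b that])
  have left: "H (tensor_map K C C C CC \<alpha> \<Delta> (\<Delta> c)) = sw (\<lambda>x y. sw (\<lambda>u v. h (\<alpha> x) u v) y) c"
  proof -
    have "H (tensor_map K C C C CC \<alpha> \<Delta> (\<Delta> c)) = sw (\<lambda>x y. H (pure_tensor K C CC (\<alpha> x) (\<Delta> y))) c"
      unfolding tensor_map_def
      by (rule linear_map_tensor_lift_comp[OF C_vs C_vs H
            bilinear_comp2[OF pure_tensor_bilinear[OF vs] twist_linear comult_linear]]) (simp add: c)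
    also have "\<dots> = sw (\<lambda>x y. sw (\<lambda>u v. h (\<alpha> x) u v) y) c"
      by (rule sw_cong) (simp add: H_pure)
    finally show ?thesis .
  qed
  let ?A = "tensor_assoc K C C C"
  note A = tensor_assoc_linear[OF C_vs C_vs C_vs]
  note HA = linear_map_comp[OF H A]
  have right: "H (?A (tensor_map K C C CC C \<Delta> \<alpha> (\<Delta> c))) = sw (\<lambda>x y. sw (\<lambda>u v. h u v (\<alpha> y)) x) c"
  proof -
    have "H (?A (tensor_map K C C CC C \<Delta> \<alpha> (\<Delta> c))) =
        sw (\<lambda>x y. H (?A (pure_tensor K CC C (\<Delta> x) (\<alpha> y)))) c"
      unfolding tensor_map_def
      by (rule linear_map_tensor_lift_comp[OF C_vs C_vs HA
            bilinear_comp2[OF pure_tensor_bilinear[OF vs(2,1)] comult_linear twist_linear]]) (simp add: c)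
    also have "\<dots> = sw (\<lambda>x y. sw (\<lambda>u v. h u v (\<alpha> y)) x) c"
    proof (rule sw_cong)
      fix x y assume x: "x \<in> carrier C" and y: "y \<in> carrier C"
      have "H (?A (pure_tensor K CC C (\<Delta> x) (\<alpha> y))) =
          H (tensor_lift K C C ?C_CC (\<lambda>u v. pure_tensor K C CC u (pure_tensor K C C v (\<alpha> y))) (\<Delta> x))"
        using x y by (simp add: tensor_assoc_pure[OF C_vs C_vs C_vs])
      also have "\<dots> = sw (\<lambda>u v. H (pure_tensor K C CC u (pure_tensor K C C v (\<alpha> y)))) x"
        by (rule linear_map_tensor_lift_comp[OF C_vs C_vs H
              trilinearD(2)[OF trilinear_pure_right[OF C_vs C_vs C_vs]]]) (simp_all add: x y)
      also have "\<dots> = sw (\<lambda>u v. h u v (\<alpha> y)) x"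
        by (rule sw_cong)
          (simp add: y H_pure bilinear_closed[OF pure_tensor_bilinear[OF C_vs C_vs]]
            tensor_lift_pure[OF C_vs C_vs trilinearD(1)[OF h]])
      finally show "H (?A (pure_tensor K CC C (\<Delta> x) (\<alpha> y))) = sw (\<lambda>u v. h u v (\<alpha> y)) x" .
    qed
    finally show ?thesis .
  qed
  show ?thesis using left right hom_coassoc[OF c] by simp
qed

lemmas sw_simps = bil_iff linear_sw sw_plus sw_diff sw_scale sw_counit_left sw_counit_right sw_twist
  counit_twist

end

section \<open>Linear combinations of a fixed finite family\<close>

context vectorspace
begin

text \<open>The vectors are indexed, since members of the family may coincide (for instance \<open>coprod3 a\<close> and
  \<open>coprod3 b\<close> for \<open>a = b\<close>); combinations indexed by a set of vectors would merge them.\<close>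

definition comb where
  "comb v n f = (\<Oplus>\<^bsub>V\<^esub>i\<in>{..<n::nat}. f i \<odot>\<^bsub>V\<^esub> v i)"

definition unit_coeff :: "nat \<Rightarrow> nat \<Rightarrow> 'a" where
  "unit_coeff i j = (if i = j then \<one>\<^bsub>K\<^esub> else \<zero>\<^bsub>K\<^esub>)"

lemma unit_coeff_closed [simp]: "unit_coeff i j \<in> carrier K"
  by (simp add: unit_coeff_def)

context
  fixes v and n :: nat assumes v: "v \<in> {..<n} \<rightarrow> carrier V"
begin

lemma comb_plus:
  assumes "\<And>i. f i \<in> carrier K" "\<And>i. g i \<in> carrier K"
  shows "comb v n f \<oplus>\<^bsub>V\<^esub> comb v n g = comb v n (\<lambda>i. f i \<oplus>\<^bsub>K\<^esub> g i)"
proof -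
  have "comb v n (\<lambda>i. f i \<oplus>\<^bsub>K\<^esub> g i) = (\<Oplus>\<^bsub>V\<^esub>i\<in>{..<n}. f i \<odot>\<^bsub>V\<^esub> v i \<oplus>\<^bsub>V\<^esub> g i \<odot>\<^bsub>V\<^esub> v i)"
    unfolding comb_def
    by (rule M.finsum_cong') (use v assms in \<open>auto simp: smult_l_distr Pi_iff\<close>)
  also have "\<dots> = comb v n f \<oplus>\<^bsub>V\<^esub> comb v n g"
    unfolding comb_def by (rule M.finsum_addf) (use v assms in \<open>auto simp: Pi_iff\<close>)
  finally show ?thesis by simp
qed

lemma comb_smult:
  assumes "\<And>i. f i \<in> carrier K" "c \<in> carrier K"
  shows "c \<odot>\<^bsub>V\<^esub> comb v n f = comb v n (\<lambda>i. c \<otimes>\<^bsub>K\<^esub> f i)"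
proof -
  have "c \<odot>\<^bsub>V\<^esub> comb v n f = (\<Oplus>\<^bsub>V\<^esub>i\<in>{..<n}. c \<odot>\<^bsub>V\<^esub> (f i \<odot>\<^bsub>V\<^esub> v i))"
    unfolding comb_def by (rule finsum_smult) (use v assms in \<open>auto simp: Pi_iff\<close>)
  also have "\<dots> = comb v n (\<lambda>i. c \<otimes>\<^bsub>K\<^esub> f i)"
    unfolding comb_def
    by (rule M.finsum_cong') (use v assms in \<open>auto simp: smult_assoc1 Pi_iff\<close>)
  finally show ?thesis .
qed

lemma comb_closed [simp]:
  "(\<And>i. f i \<in> carrier K) \<Longrightarrow> comb v n f \<in> carrier V"
  unfolding comb_def by (rule M.finsum_closed) (use v in \<open>auto simp: Pi_iff\<close>)

lemma comb_diff:
  assumes "\<And>i. f i \<in> carrier K" "\<And>i. g i \<in> carrier K"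
  shows "comb v n f \<ominus>\<^bsub>V\<^esub> comb v n g = comb v n (\<lambda>i. f i \<ominus>\<^bsub>K\<^esub> g i)"
proof -
  have "comb v n f \<ominus>\<^bsub>V\<^esub> comb v n g = comb v n f \<oplus>\<^bsub>V\<^esub> (\<ominus>\<^bsub>K\<^esub> \<one>\<^bsub>K\<^esub>) \<odot>\<^bsub>V\<^esub> comb v n g"
    using assms by (simp add: smult_minus_1 a_minus_def)
  also have "\<dots> = comb v n (\<lambda>i. f i \<oplus>\<^bsub>K\<^esub> (\<ominus>\<^bsub>K\<^esub> \<one>\<^bsub>K\<^esub>) \<otimes>\<^bsub>K\<^esub> g i)"
    using assms by (simp add: comb_smult comb_plus)
  finally show ?thesis using assms by (simp add: a_minus_def R.l_minus)
qed

lemma comb_unit: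
  assumes i: "i < n"
  shows "v i = comb v n (unit_coeff i)"
proof -
  have "comb v n (unit_coeff i) = (\<Oplus>\<^bsub>V\<^esub>j\<in>{..<n}. if i = j then v j else \<zero>\<^bsub>V\<^esub>)"
    unfolding comb_def unit_coeff_def
    by (rule M.finsum_cong') (use v in \<open>auto simp: Pi_iff\<close>)
  also have "\<dots> = v i"
    by (rule M.finsum_singleton) (use v i in auto)
  finally show ?thesis by simp
qed

lemma comb_cong:
  assumes "\<And>i. i < n \<Longrightarrow> f i = g i" "\<And>i. i < n \<Longrightarrow> g i \<in> carrier K"
  shows "comb v n f = comb v n g"
  unfolding comb_def by (rule M.finsum_cong') (use v assms in \<open>auto simp: Pi_iff\<close>)

end

end

section \<open>Expansion of the two sides of the Hom-Yang-Baxter equation\<close>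

context hom_coalgebra
begin

text \<open>In Sweedler notation, these are the normal forms \<open>\<alpha>(c\<^sub>1\<^sub>1) \<otimes> \<alpha>(c\<^sub>1\<^sub>2) \<otimes> \<alpha>\<^sup>2(c\<^sub>2)\<close>,
  \<open>\<alpha>\<^sup>2(c\<^sub>1) \<otimes> \<alpha>\<^sup>2(c\<^sub>2) \<otimes> \<alpha>\<^sup>3(a)\<close> and \<open>\<alpha>\<^sup>3(c) \<otimes> \<alpha>\<^sup>2(a\<^sub>1) \<otimes> \<alpha>\<^sup>2(a\<^sub>2)\<close> of the tensors in the expansions.\<close>

definition "coprod3 c = sw (\<lambda>x y. sw (\<lambda>u v. tri (\<alpha> u) (\<alpha> v) (\<alpha> (\<alpha> y))) x) c"
definition "coprod_left c a = sw (\<lambda>x y. tri (\<alpha> (\<alpha> x)) (\<alpha> (\<alpha> y)) (\<alpha> (\<alpha> (\<alpha> a)))) c"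
definition "coprod_right c a = sw (\<lambda>x y. tri (\<alpha> (\<alpha> (\<alpha> c))) (\<alpha> (\<alpha> x)) (\<alpha> (\<alpha> y))) a"

lemma coprod_closed [simp]:
  "c \<in> carrier C \<Longrightarrow> coprod3 c \<in> carrier CCC"
  "a \<in> carrier C \<Longrightarrow> c \<in> carrier C \<Longrightarrow> coprod_left c a \<in> carrier CCC"
  "a \<in> carrier C \<Longrightarrow> c \<in> carrier C \<Longrightarrow> coprod_right c a \<in> carrier CCC"
  by (simp_all add: coprod3_def coprod_left_def coprod_right_def bil_iff)

lemma coprod3_right:
  assumes "c \<in> carrier C"
  shows "sw (\<lambda>x y. sw (\<lambda>u v. tri (\<alpha> (\<alpha> x)) (\<alpha> u) (\<alpha> v)) y) c = coprod3 c"
  unfolding coprod3_def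
  by (rule sw_coassoc[of "\<lambda>x u v. tri (\<alpha> x) (\<alpha> u) (\<alpha> v)"]) (auto intro: trilinearI simp: assms)

text \<open>For \<open>R = F p q\<close>, \<open>S = F r s\<close> and \<open>T = F t u\<close>, these equations compare the coefficients of
  \<open>R\<^sup>1\<^sup>2 S\<^sup>1\<^sup>3 T\<^sup>2\<^sup>3\<close> and \<open>T\<^sup>2\<^sup>3 S\<^sup>1\<^sup>3 R\<^sup>1\<^sup>2\<close> at \<open>coprod3 b\<close>, \<open>coprod_left c a\<close>, \<open>coprod_left b a\<close>,
  \<open>coprod_right c b\<close> and \<open>coprod_right c a\<close>.\<close>

definition braid_scalars where
  "braid_scalars p q r s t u \<longleftrightarrow>
    u \<otimes>\<^bsub>K\<^esub> r \<otimes>\<^bsub>K\<^esub> (p \<oplus>\<^bsub>K\<^esub> q \<ominus>\<^bsub>K\<^esub> \<one>\<^bsub>K\<^esub>) \<ominus>\<^bsub>K\<^esub> r \<otimes>\<^bsub>K\<^esub> q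
      = p \<otimes>\<^bsub>K\<^esub> s \<otimes>\<^bsub>K\<^esub> (t \<oplus>\<^bsub>K\<^esub> u \<ominus>\<^bsub>K\<^esub> \<one>\<^bsub>K\<^esub>) \<ominus>\<^bsub>K\<^esub> s \<otimes>\<^bsub>K\<^esub> t \<and>
    t \<otimes>\<^bsub>K\<^esub> s \<otimes>\<^bsub>K\<^esub> p \<ominus>\<^bsub>K\<^esub> t \<otimes>\<^bsub>K\<^esub> (p \<oplus>\<^bsub>K\<^esub> q \<ominus>\<^bsub>K\<^esub> \<one>\<^bsub>K\<^esub>) \<ominus>\<^bsub>K\<^esub> s \<otimes>\<^bsub>K\<^esub> p \<oplus>\<^bsub>K\<^esub> p
      = r \<ominus>\<^bsub>K\<^esub> q \<otimes>\<^bsub>K\<^esub> r \<and>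
    u \<otimes>\<^bsub>K\<^esub> s \<otimes>\<^bsub>K\<^esub> p \<ominus>\<^bsub>K\<^esub> u \<otimes>\<^bsub>K\<^esub> (p \<oplus>\<^bsub>K\<^esub> q \<ominus>\<^bsub>K\<^esub> \<one>\<^bsub>K\<^esub>) \<oplus>\<^bsub>K\<^esub> q = s \<and>
    p \<otimes>\<^bsub>K\<^esub> r \<otimes>\<^bsub>K\<^esub> u \<ominus>\<^bsub>K\<^esub> p \<otimes>\<^bsub>K\<^esub> (t \<oplus>\<^bsub>K\<^esub> u \<ominus>\<^bsub>K\<^esub> \<one>\<^bsub>K\<^esub>) \<oplus>\<^bsub>K\<^esub> t = r \<and>
    q \<otimes>\<^bsub>K\<^esub> r \<otimes>\<^bsub>K\<^esub> u \<ominus>\<^bsub>K\<^esub> q \<otimes>\<^bsub>K\<^esub> (t \<oplus>\<^bsub>K\<^esub> u \<ominus>\<^bsub>K\<^esub> \<one>\<^bsub>K\<^esub>) \<ominus>\<^bsub>K\<^esub> r \<otimes>\<^bsub>K\<^esub> u \<oplus>\<^bsub>K\<^esub> u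
      = s \<ominus>\<^bsub>K\<^esub> t \<otimes>\<^bsub>K\<^esub> s"

end

text \<open>The computation uses only the values of the three operators on pure tensors. In these, the scalar is kept apart
  from the counit: a scalar factor can always be pulled out of a Sweedler sum, whereas the counit of a
  Sweedler component must stay inside, to be absorbed by the counit axiom.\<close>

locale yang_baxter_operators = hom_coalgebra +
  fixes R12 S13 T23 p q r s t u
  assumes coeffs [simp]: "p \<in> carrier K" "q \<in> carrier K" "r \<in> carrier K" "s \<in> carrier K"
      "t \<in> carrier K" "u \<in> carrier K"
    and R12 [simp]: "linear_map K CCC CCC R12" and S13 [simp]: "linear_map K CCC CCC S13"
    and T23 [simp]: "linear_map K CCC CCC T23"
    and R12_tri: "\<And>a b c. a \<in> carrier C \<Longrightarrow> b \<in> carrier C \<Longrightarrow> c \<in> carrier C \<Longrightarrow> R12 (tri a b c) =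
      p \<odot>\<^bsub>CCC\<^esub> (\<epsilon> a \<odot>\<^bsub>CCC\<^esub> sw (\<lambda>x y. tri x y (\<alpha> c)) b) \<oplus>\<^bsub>CCC\<^esub>
      q \<odot>\<^bsub>CCC\<^esub> (\<epsilon> b \<odot>\<^bsub>CCC\<^esub> sw (\<lambda>x y. tri x y (\<alpha> c)) a) \<ominus>\<^bsub>CCC\<^esub> tri (\<alpha> b) (\<alpha> a) (\<alpha> c)"
    and S13_tri: "\<And>a b c. a \<in> carrier C \<Longrightarrow> b \<in> carrier C \<Longrightarrow> c \<in> carrier C \<Longrightarrow> S13 (tri a b c) =
      r \<odot>\<^bsub>CCC\<^esub> (\<epsilon> a \<odot>\<^bsub>CCC\<^esub> sw (\<lambda>x y. tri x (\<alpha> b) y) c) \<oplus>\<^bsub>CCC\<^esub>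
      s \<odot>\<^bsub>CCC\<^esub> (\<epsilon> c \<odot>\<^bsub>CCC\<^esub> sw (\<lambda>x y. tri x (\<alpha> b) y) a) \<ominus>\<^bsub>CCC\<^esub> tri (\<alpha> c) (\<alpha> b) (\<alpha> a)"
    and T23_tri: "\<And>a b c. a \<in> carrier C \<Longrightarrow> b \<in> carrier C \<Longrightarrow> c \<in> carrier C \<Longrightarrow> T23 (tri a b c) =
      t \<odot>\<^bsub>CCC\<^esub> (\<epsilon> b \<odot>\<^bsub>CCC\<^esub> sw (\<lambda>x y. tri (\<alpha> a) x y) c) \<oplus>\<^bsub>CCC\<^esub>
      u \<odot>\<^bsub>CCC\<^esub> (\<epsilon> c \<odot>\<^bsub>CCC\<^esub> sw (\<lambda>x y. tri (\<alpha> a) x y) b) \<ominus>\<^bsub>CCC\<^esub> tri (\<alpha> a) (\<alpha> c) (\<alpha> b)"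
begin

text \<open>The middle operator is applied to the Sweedler sums that the first operator produces. It yields
  three kinds of tensors: an iterated coproduct, a coproduct in the two outer factors, and a coproduct with its
  components swapped.\<close>

lemma S13_left:
  assumes [simp]: "a \<in> carrier C" "c \<in> carrier C"
  shows "S13 (sw (\<lambda>x y. tri (\<alpha> a) x y) c) =
    r \<odot>\<^bsub>CCC\<^esub> (\<epsilon> a \<odot>\<^bsub>CCC\<^esub> sw (\<lambda>x y. sw (\<lambda>u v. tri u (\<alpha> x) v) y) c) \<oplus>\<^bsub>CCC\<^esub>
    s \<odot>\<^bsub>CCC\<^esub> sw (\<lambda>u v. tri (\<alpha> u) (\<alpha> (\<alpha> c)) (\<alpha> v)) a \<ominus>\<^bsub>CCC\<^esub>
    sw (\<lambda>x y. tri (\<alpha> y) (\<alpha> x) (\<alpha> (\<alpha> a))) c"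
  by (simp add: S13_tri sw_simps)

lemma S13_right:
  assumes [simp]: "b \<in> carrier C" "c \<in> carrier C"
  shows "S13 (sw (\<lambda>x y. tri x y (\<alpha> c)) b) =
    r \<odot>\<^bsub>CCC\<^esub> sw (\<lambda>u v. tri (\<alpha> u) (\<alpha> (\<alpha> b)) (\<alpha> v)) c \<oplus>\<^bsub>CCC\<^esub>
    s \<odot>\<^bsub>CCC\<^esub> (\<epsilon> c \<odot>\<^bsub>CCC\<^esub> sw (\<lambda>x y. sw (\<lambda>u v. tri u (\<alpha> y) v) x) b) \<ominus>\<^bsub>CCC\<^esub>
    sw (\<lambda>x y. tri (\<alpha> (\<alpha> c)) (\<alpha> y) (\<alpha> x)) b"
  by (simp add: S13_tri sw_simps)

text \<open>The last operator brings each of the three kinds of tensors to normal form. In the nested and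
  the swapped case its three summands lead to the same tensor, whence the factors \<open>p + q - 1\<close> and \<open>t + u - 1\<close> in
  \<open>braid_scalars\<close>.\<close>

lemma R12_nested:
  assumes [simp]: "c \<in> carrier C"
  shows "R12 (sw (\<lambda>x y. sw (\<lambda>u v. tri u (\<alpha> x) v) y) c) =
    p \<odot>\<^bsub>CCC\<^esub> coprod3 c \<oplus>\<^bsub>CCC\<^esub> q \<odot>\<^bsub>CCC\<^esub> coprod3 c \<ominus>\<^bsub>CCC\<^esub> coprod3 c"
  by (simp add: R12_tri sw_simps coprod3_right) (simp add: coprod3_def)

lemma R12_outer:
  assumes [simp]: "a \<in> carrier C" "c \<in> carrier C"
  shows "R12 (sw (\<lambda>u v. tri (\<alpha> u) (\<alpha> (\<alpha> c)) (\<alpha> v)) a) =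
    p \<odot>\<^bsub>CCC\<^esub> coprod_left c a \<oplus>\<^bsub>CCC\<^esub> q \<odot>\<^bsub>CCC\<^esub> (\<epsilon> c \<odot>\<^bsub>CCC\<^esub> coprod3 a) \<ominus>\<^bsub>CCC\<^esub> coprod_right c a"
  by (simp add: R12_tri sw_simps coprod3_def coprod_left_def coprod_right_def)

lemma R12_swapped:
  assumes [simp]: "a \<in> carrier C" "c \<in> carrier C"
  shows "R12 (sw (\<lambda>x y. tri (\<alpha> y) (\<alpha> x) (\<alpha> (\<alpha> a))) c) =
    p \<odot>\<^bsub>CCC\<^esub> coprod_left c a \<oplus>\<^bsub>CCC\<^esub> q \<odot>\<^bsub>CCC\<^esub> coprod_left c a \<ominus>\<^bsub>CCC\<^esub> coprod_left c a"
  by (simp add: R12_tri sw_simps coprod_left_def)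

lemma T23_nested:
  assumes [simp]: "b \<in> carrier C"
  shows "T23 (sw (\<lambda>x y. sw (\<lambda>u v. tri u (\<alpha> y) v) x) b) =
    t \<odot>\<^bsub>CCC\<^esub> coprod3 b \<oplus>\<^bsub>CCC\<^esub> u \<odot>\<^bsub>CCC\<^esub> coprod3 b \<ominus>\<^bsub>CCC\<^esub> coprod3 b"
  by (simp add: T23_tri sw_simps coprod3_right) (simp add: coprod3_def)

lemma T23_outer:
  assumes [simp]: "b \<in> carrier C" "c \<in> carrier C"
  shows "T23 (sw (\<lambda>u v. tri (\<alpha> u) (\<alpha> (\<alpha> b)) (\<alpha> v)) c) =
    t \<odot>\<^bsub>CCC\<^esub> (\<epsilon> b \<odot>\<^bsub>CCC\<^esub> coprod3 c) \<oplus>\<^bsub>CCC\<^esub> u \<odot>\<^bsub>CCC\<^esub> coprod_right c b \<ominus>\<^bsub>CCC\<^esub> coprod_left c b"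
  by (simp add: T23_tri sw_simps coprod3_right) (simp add: coprod_left_def coprod_right_def)

lemma T23_swapped:
  assumes [simp]: "b \<in> carrier C" "c \<in> carrier C"
  shows "T23 (sw (\<lambda>x y. tri (\<alpha> (\<alpha> c)) (\<alpha> y) (\<alpha> x)) b) =
    t \<odot>\<^bsub>CCC\<^esub> coprod_right c b \<oplus>\<^bsub>CCC\<^esub> u \<odot>\<^bsub>CCC\<^esub> coprod_right c b \<ominus>\<^bsub>CCC\<^esub> coprod_right c b"
  by (simp add: T23_tri sw_simps coprod_right_def)

lemmas op_linear = linear_mapD[OF R12] linear_mapD[OF S13] linear_mapD[OF T23]

lemma R12_S13_T23_tri:
  assumes [simp]: "a \<in> carrier C" "b \<in> carrier C" "c \<in> carrier C"
  shows "R12 (S13 (T23 (tri a b c))) =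
    t \<odot>\<^bsub>CCC\<^esub> (\<epsilon> b \<odot>\<^bsub>CCC\<^esub>
      (r \<odot>\<^bsub>CCC\<^esub> (\<epsilon> a \<odot>\<^bsub>CCC\<^esub>
          (p \<odot>\<^bsub>CCC\<^esub> coprod3 c \<oplus>\<^bsub>CCC\<^esub> q \<odot>\<^bsub>CCC\<^esub> coprod3 c \<ominus>\<^bsub>CCC\<^esub> coprod3 c))
        \<oplus>\<^bsub>CCC\<^esub> s \<odot>\<^bsub>CCC\<^esub> (p \<odot>\<^bsub>CCC\<^esub> coprod_left c a
          \<oplus>\<^bsub>CCC\<^esub> q \<odot>\<^bsub>CCC\<^esub> (\<epsilon> c \<odot>\<^bsub>CCC\<^esub> coprod3 a) \<ominus>\<^bsub>CCC\<^esub> coprod_right c a)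
        \<ominus>\<^bsub>CCC\<^esub> (p \<odot>\<^bsub>CCC\<^esub> coprod_left c a \<oplus>\<^bsub>CCC\<^esub> q \<odot>\<^bsub>CCC\<^esub> coprod_left c a
          \<ominus>\<^bsub>CCC\<^esub> coprod_left c a)))
    \<oplus>\<^bsub>CCC\<^esub> u \<odot>\<^bsub>CCC\<^esub> (\<epsilon> c \<odot>\<^bsub>CCC\<^esub>
      (r \<odot>\<^bsub>CCC\<^esub> (\<epsilon> a \<odot>\<^bsub>CCC\<^esub>
          (p \<odot>\<^bsub>CCC\<^esub> coprod3 b \<oplus>\<^bsub>CCC\<^esub> q \<odot>\<^bsub>CCC\<^esub> coprod3 b \<ominus>\<^bsub>CCC\<^esub> coprod3 b))
        \<oplus>\<^bsub>CCC\<^esub> s \<odot>\<^bsub>CCC\<^esub> (p \<odot>\<^bsub>CCC\<^esub> coprod_left b a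
          \<oplus>\<^bsub>CCC\<^esub> q \<odot>\<^bsub>CCC\<^esub> (\<epsilon> b \<odot>\<^bsub>CCC\<^esub> coprod3 a) \<ominus>\<^bsub>CCC\<^esub> coprod_right b a)
        \<ominus>\<^bsub>CCC\<^esub> (p \<odot>\<^bsub>CCC\<^esub> coprod_left b a \<oplus>\<^bsub>CCC\<^esub> q \<odot>\<^bsub>CCC\<^esub> coprod_left b a
          \<ominus>\<^bsub>CCC\<^esub> coprod_left b a)))
    \<ominus>\<^bsub>CCC\<^esub> (r \<odot>\<^bsub>CCC\<^esub> (\<epsilon> a \<odot>\<^bsub>CCC\<^esub> (p \<odot>\<^bsub>CCC\<^esub> coprod_left c b
          \<oplus>\<^bsub>CCC\<^esub> q \<odot>\<^bsub>CCC\<^esub> (\<epsilon> c \<odot>\<^bsub>CCC\<^esub> coprod3 b) \<ominus>\<^bsub>CCC\<^esub> coprod_right c b))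
        \<oplus>\<^bsub>CCC\<^esub> s \<odot>\<^bsub>CCC\<^esub> (\<epsilon> b \<odot>\<^bsub>CCC\<^esub> (p \<odot>\<^bsub>CCC\<^esub> coprod_left c a
          \<oplus>\<^bsub>CCC\<^esub> q \<odot>\<^bsub>CCC\<^esub> (\<epsilon> c \<odot>\<^bsub>CCC\<^esub> coprod3 a) \<ominus>\<^bsub>CCC\<^esub> coprod_right c a))
        \<ominus>\<^bsub>CCC\<^esub> (p \<odot>\<^bsub>CCC\<^esub> (\<epsilon> b \<odot>\<^bsub>CCC\<^esub> coprod_left c a)
          \<oplus>\<^bsub>CCC\<^esub> q \<odot>\<^bsub>CCC\<^esub> (\<epsilon> c \<odot>\<^bsub>CCC\<^esub> coprod_left b a)
          \<ominus>\<^bsub>CCC\<^esub> tri (\<alpha> (\<alpha> (\<alpha> c))) (\<alpha> (\<alpha> (\<alpha> b))) (\<alpha> (\<alpha> (\<alpha> a)))))"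
  by (simp add: T23_tri S13_left S13_tri R12_tri R12_nested R12_outer R12_swapped op_linear bil_iff sw_twist
      counit_twist coprod3_def coprod_left_def coprod_right_def)

lemma T23_S13_R12_tri:
  assumes [simp]: "a \<in> carrier C" "b \<in> carrier C" "c \<in> carrier C"
  shows "T23 (S13 (R12 (tri a b c))) =
    p \<odot>\<^bsub>CCC\<^esub> (\<epsilon> a \<odot>\<^bsub>CCC\<^esub>
      (r \<odot>\<^bsub>CCC\<^esub> (t \<odot>\<^bsub>CCC\<^esub> (\<epsilon> b \<odot>\<^bsub>CCC\<^esub> coprod3 c)
          \<oplus>\<^bsub>CCC\<^esub> u \<odot>\<^bsub>CCC\<^esub> coprod_right c b \<ominus>\<^bsub>CCC\<^esub> coprod_left c b)
        \<oplus>\<^bsub>CCC\<^esub> s \<odot>\<^bsub>CCC\<^esub> (\<epsilon> c \<odot>\<^bsub>CCC\<^esub>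
          (t \<odot>\<^bsub>CCC\<^esub> coprod3 b \<oplus>\<^bsub>CCC\<^esub> u \<odot>\<^bsub>CCC\<^esub> coprod3 b \<ominus>\<^bsub>CCC\<^esub> coprod3 b))
        \<ominus>\<^bsub>CCC\<^esub> (t \<odot>\<^bsub>CCC\<^esub> coprod_right c b \<oplus>\<^bsub>CCC\<^esub> u \<odot>\<^bsub>CCC\<^esub> coprod_right c b
          \<ominus>\<^bsub>CCC\<^esub> coprod_right c b)))
    \<oplus>\<^bsub>CCC\<^esub> q \<odot>\<^bsub>CCC\<^esub> (\<epsilon> b \<odot>\<^bsub>CCC\<^esub>
      (r \<odot>\<^bsub>CCC\<^esub> (t \<odot>\<^bsub>CCC\<^esub> (\<epsilon> a \<odot>\<^bsub>CCC\<^esub> coprod3 c)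
          \<oplus>\<^bsub>CCC\<^esub> u \<odot>\<^bsub>CCC\<^esub> coprod_right c a \<ominus>\<^bsub>CCC\<^esub> coprod_left c a)
        \<oplus>\<^bsub>CCC\<^esub> s \<odot>\<^bsub>CCC\<^esub> (\<epsilon> c \<odot>\<^bsub>CCC\<^esub>
          (t \<odot>\<^bsub>CCC\<^esub> coprod3 a \<oplus>\<^bsub>CCC\<^esub> u \<odot>\<^bsub>CCC\<^esub> coprod3 a \<ominus>\<^bsub>CCC\<^esub> coprod3 a))
        \<ominus>\<^bsub>CCC\<^esub> (t \<odot>\<^bsub>CCC\<^esub> coprod_right c a \<oplus>\<^bsub>CCC\<^esub> u \<odot>\<^bsub>CCC\<^esub> coprod_right c a
          \<ominus>\<^bsub>CCC\<^esub> coprod_right c a)))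
    \<ominus>\<^bsub>CCC\<^esub> (r \<odot>\<^bsub>CCC\<^esub> (\<epsilon> b \<odot>\<^bsub>CCC\<^esub> (t \<odot>\<^bsub>CCC\<^esub> (\<epsilon> a \<odot>\<^bsub>CCC\<^esub> coprod3 c)
          \<oplus>\<^bsub>CCC\<^esub> u \<odot>\<^bsub>CCC\<^esub> coprod_right c a \<ominus>\<^bsub>CCC\<^esub> coprod_left c a))
        \<oplus>\<^bsub>CCC\<^esub> s \<odot>\<^bsub>CCC\<^esub> (\<epsilon> c \<odot>\<^bsub>CCC\<^esub> (t \<odot>\<^bsub>CCC\<^esub> (\<epsilon> a \<odot>\<^bsub>CCC\<^esub> coprod3 b)
          \<oplus>\<^bsub>CCC\<^esub> u \<odot>\<^bsub>CCC\<^esub> coprod_right b a \<ominus>\<^bsub>CCC\<^esub> coprod_left b a))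
        \<ominus>\<^bsub>CCC\<^esub> (t \<odot>\<^bsub>CCC\<^esub> (\<epsilon> a \<odot>\<^bsub>CCC\<^esub> coprod_right c b)
          \<oplus>\<^bsub>CCC\<^esub> u \<odot>\<^bsub>CCC\<^esub> (\<epsilon> b \<odot>\<^bsub>CCC\<^esub> coprod_right c a)
          \<ominus>\<^bsub>CCC\<^esub> tri (\<alpha> (\<alpha> (\<alpha> c))) (\<alpha> (\<alpha> (\<alpha> b))) (\<alpha> (\<alpha> (\<alpha> a)))))"
  by (simp add: R12_tri S13_right S13_tri T23_tri T23_nested T23_outer T23_swapped op_linear bil_iff sw_twist
      counit_twist coprod3_def coprod_left_def coprod_right_def)

context
  fixes a b c
  assumes [simp]: "a \<in> carrier C" "b \<in> carrier C" "c \<in> carrier C"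
begin

definition "braid_terms = (!) [coprod3 c, coprod3 b, coprod3 a,
  coprod_left c a, coprod_left b a, coprod_left c b,
  coprod_right c b, coprod_right c a, coprod_right b a,
  tri (\<alpha> (\<alpha> (\<alpha> c))) (\<alpha> (\<alpha> (\<alpha> b))) (\<alpha> (\<alpha> (\<alpha> a)))]"

lemma below_ten: "i < (10::nat) \<Longrightarrow> i = 0 \<or> i = 1 \<or> i = 2 \<or> i = 3 \<or> i = 4 \<or> i = 5 \<or> i = 6 \<or>
    i = 7 \<or> i = 8 \<or> i = 9"
  by arith

lemma braid_terms_closed: "braid_terms \<in> {..<10} \<rightarrow> carrier CCC"
  by (auto simp: braid_terms_def dest!: below_ten)

lemmas braid_terms_comb = CCC.comb_plus[OF braid_terms_closed] CCC.comb_smult[OF braid_terms_closed]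
  CCC.comb_diff[OF braid_terms_closed]

lemmas braid_terms_unit = CCC.comb_unit[OF braid_terms_closed]

lemma braid_terms_expand:
  "coprod3 c = CCC.comb braid_terms 10 (CCC.unit_coeff 0)"
  "coprod3 b = CCC.comb braid_terms 10 (CCC.unit_coeff 1)"
  "coprod3 a = CCC.comb braid_terms 10 (CCC.unit_coeff 2)"
  "coprod_left c a = CCC.comb braid_terms 10 (CCC.unit_coeff 3)"
  "coprod_left b a = CCC.comb braid_terms 10 (CCC.unit_coeff 4)"
  "coprod_left c b = CCC.comb braid_terms 10 (CCC.unit_coeff 5)"
  "coprod_right c b = CCC.comb braid_terms 10 (CCC.unit_coeff 6)"
  "coprod_right c a = CCC.comb braid_terms 10 (CCC.unit_coeff 7)"
  "coprod_right b a = CCC.comb braid_terms 10 (CCC.unit_coeff 8)"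
  "tri (\<alpha> (\<alpha> (\<alpha> c))) (\<alpha> (\<alpha> (\<alpha> b))) (\<alpha> (\<alpha> (\<alpha> a))) = CCC.comb braid_terms 10 (CCC.unit_coeff 9)"
  using braid_terms_unit[of 0] braid_terms_unit[of 1] braid_terms_unit[of 2]
    braid_terms_unit[of 3] braid_terms_unit[of 4] braid_terms_unit[of 5] braid_terms_unit[of 6]
    braid_terms_unit[of 7] braid_terms_unit[of 8] braid_terms_unit[of 9]
  by (simp_all add: braid_terms_def[THEN fun_cong])

lemmas K_normalize = R.l_distr R.r_distr R.m_ac R.a_ac R.l_minus R.r_minus R.minus_add a_minus_def

text \<open>Once the ten tensors are written as combinations with unit coefficients, the module operations act on
  coefficient functions, and the claim reduces to ten identities in the field.\<close>

lemma R12_S13_T23_comb: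
  "R12 (S13 (T23 (tri a b c))) = CCC.comb braid_terms 10 ((!)
    [(t \<otimes>\<^bsub>K\<^esub> r \<otimes>\<^bsub>K\<^esub> (p \<oplus>\<^bsub>K\<^esub> q \<ominus>\<^bsub>K\<^esub> \<one>\<^bsub>K\<^esub>)) \<otimes>\<^bsub>K\<^esub> (\<epsilon> a \<otimes>\<^bsub>K\<^esub> \<epsilon> b),
     (u \<otimes>\<^bsub>K\<^esub> r \<otimes>\<^bsub>K\<^esub> (p \<oplus>\<^bsub>K\<^esub> q \<ominus>\<^bsub>K\<^esub> \<one>\<^bsub>K\<^esub>) \<ominus>\<^bsub>K\<^esub> r \<otimes>\<^bsub>K\<^esub> q) \<otimes>\<^bsub>K\<^esub> (\<epsilon> a \<otimes>\<^bsub>K\<^esub> \<epsilon> c),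
     (s \<otimes>\<^bsub>K\<^esub> q \<otimes>\<^bsub>K\<^esub> (t \<oplus>\<^bsub>K\<^esub> u \<ominus>\<^bsub>K\<^esub> \<one>\<^bsub>K\<^esub>)) \<otimes>\<^bsub>K\<^esub> (\<epsilon> b \<otimes>\<^bsub>K\<^esub> \<epsilon> c),
     (t \<otimes>\<^bsub>K\<^esub> s \<otimes>\<^bsub>K\<^esub> p \<ominus>\<^bsub>K\<^esub> t \<otimes>\<^bsub>K\<^esub> (p \<oplus>\<^bsub>K\<^esub> q \<ominus>\<^bsub>K\<^esub> \<one>\<^bsub>K\<^esub>) \<ominus>\<^bsub>K\<^esub> s \<otimes>\<^bsub>K\<^esub> p \<oplus>\<^bsub>K\<^esub> p) \<otimes>\<^bsub>K\<^esub> \<epsilon> b,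
     (u \<otimes>\<^bsub>K\<^esub> s \<otimes>\<^bsub>K\<^esub> p \<ominus>\<^bsub>K\<^esub> u \<otimes>\<^bsub>K\<^esub> (p \<oplus>\<^bsub>K\<^esub> q \<ominus>\<^bsub>K\<^esub> \<one>\<^bsub>K\<^esub>) \<oplus>\<^bsub>K\<^esub> q) \<otimes>\<^bsub>K\<^esub> \<epsilon> c,
     (\<ominus>\<^bsub>K\<^esub> (r \<otimes>\<^bsub>K\<^esub> p)) \<otimes>\<^bsub>K\<^esub> \<epsilon> a,
     r \<otimes>\<^bsub>K\<^esub> \<epsilon> a,
     (s \<ominus>\<^bsub>K\<^esub> t \<otimes>\<^bsub>K\<^esub> s) \<otimes>\<^bsub>K\<^esub> \<epsilon> b,
     (\<ominus>\<^bsub>K\<^esub> (u \<otimes>\<^bsub>K\<^esub> s)) \<otimes>\<^bsub>K\<^esub> \<epsilon> c,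
     \<ominus>\<^bsub>K\<^esub> \<one>\<^bsub>K\<^esub>])"
  apply (simp only: R12_S13_T23_tri braid_terms_expand \<open>a \<in> carrier C\<close> \<open>b \<in> carrier C\<close> \<open>c \<in> carrier C\<close>)
  apply (simp add: braid_terms_comb)
  \<comment> \<open>Both sides are now combinations of \<open>braid_terms\<close>; the coefficients are compared one by one.\<close>
  apply (rule CCC.comb_cong[OF braid_terms_closed])
   apply (drule below_ten)
   apply (elim disjE; simp add: CCC.unit_coeff_def K_normalize)
  apply (drule below_ten)
  apply (elim disjE; simp)
  done

lemma T23_S13_R12_comb:
  "T23 (S13 (R12 (tri a b c))) = CCC.comb braid_terms 10 ((!)
    [(t \<otimes>\<^bsub>K\<^esub> r \<otimes>\<^bsub>K\<^esub> (p \<oplus>\<^bsub>K\<^esub> q \<ominus>\<^bsub>K\<^esub> \<one>\<^bsub>K\<^esub>)) \<otimes>\<^bsub>K\<^esub> (\<epsilon> a \<otimes>\<^bsub>K\<^esub> \<epsilon> b),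
     (p \<otimes>\<^bsub>K\<^esub> s \<otimes>\<^bsub>K\<^esub> (t \<oplus>\<^bsub>K\<^esub> u \<ominus>\<^bsub>K\<^esub> \<one>\<^bsub>K\<^esub>) \<ominus>\<^bsub>K\<^esub> s \<otimes>\<^bsub>K\<^esub> t) \<otimes>\<^bsub>K\<^esub> (\<epsilon> a \<otimes>\<^bsub>K\<^esub> \<epsilon> c),
     (s \<otimes>\<^bsub>K\<^esub> q \<otimes>\<^bsub>K\<^esub> (t \<oplus>\<^bsub>K\<^esub> u \<ominus>\<^bsub>K\<^esub> \<one>\<^bsub>K\<^esub>)) \<otimes>\<^bsub>K\<^esub> (\<epsilon> b \<otimes>\<^bsub>K\<^esub> \<epsilon> c),
     (r \<ominus>\<^bsub>K\<^esub> q \<otimes>\<^bsub>K\<^esub> r) \<otimes>\<^bsub>K\<^esub> \<epsilon> b,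
     s \<otimes>\<^bsub>K\<^esub> \<epsilon> c,
     (\<ominus>\<^bsub>K\<^esub> (r \<otimes>\<^bsub>K\<^esub> p)) \<otimes>\<^bsub>K\<^esub> \<epsilon> a,
     (p \<otimes>\<^bsub>K\<^esub> r \<otimes>\<^bsub>K\<^esub> u \<ominus>\<^bsub>K\<^esub> p \<otimes>\<^bsub>K\<^esub> (t \<oplus>\<^bsub>K\<^esub> u \<ominus>\<^bsub>K\<^esub> \<one>\<^bsub>K\<^esub>) \<oplus>\<^bsub>K\<^esub> t) \<otimes>\<^bsub>K\<^esub> \<epsilon> a,
     (q \<otimes>\<^bsub>K\<^esub> r \<otimes>\<^bsub>K\<^esub> u \<ominus>\<^bsub>K\<^esub> q \<otimes>\<^bsub>K\<^esub> (t \<oplus>\<^bsub>K\<^esub> u \<ominus>\<^bsub>K\<^esub> \<one>\<^bsub>K\<^esub>) \<ominus>\<^bsub>K\<^esub> r \<otimes>\<^bsub>K\<^esub> u \<oplus>\<^bsub>K\<^esub> u) \<otimes>\<^bsub>K\<^esub> \<epsilon> b,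
     (\<ominus>\<^bsub>K\<^esub> (u \<otimes>\<^bsub>K\<^esub> s)) \<otimes>\<^bsub>K\<^esub> \<epsilon> c,
     \<ominus>\<^bsub>K\<^esub> \<one>\<^bsub>K\<^esub>])"
  apply (simp only: T23_S13_R12_tri braid_terms_expand \<open>a \<in> carrier C\<close> \<open>b \<in> carrier C\<close> \<open>c \<in> carrier C\<close>)
  apply (simp add: braid_terms_comb)
  \<comment> \<open>Both sides are now combinations of \<open>braid_terms\<close>; the coefficients are compared one by one.\<close>
  apply (rule CCC.comb_cong[OF braid_terms_closed])
   apply (drule below_ten)
   apply (elim disjE; simp add: CCC.unit_coeff_def K_normalize)
  apply (drule below_ten)
  apply (elim disjE; simp)
  done

end

lemma braid_equal:
  assumes braid: "braid_scalars p q r s t u"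
    and x: "x \<in> carrier CCC"
  shows "R12 (S13 (T23 x)) = T23 (S13 (R12 x))"
proof (rule linear_eq_on_triple_tensor[OF C_vs C_vs C_vs _ _ _ x])
  show "linear_map K CCC CCC (\<lambda>x. R12 (S13 (T23 x)))" "linear_map K CCC CCC (\<lambda>x. T23 (S13 (R12 x)))"
    by (rule linear_map_comp[OF R12 linear_map_comp[OF S13 T23]] linear_map_comp[OF T23 linear_map_comp[OF S13 R12]])+
  fix a b c assume abc: "a \<in> carrier C" "b \<in> carrier C" "c \<in> carrier C"
  show "R12 (S13 (T23 (pure_tensor K CC C (pure_tensor K C C a b) c))) =
      T23 (S13 (R12 (pure_tensor K CC C (pure_tensor K C C a b) c)))"
    unfolding tri_def[symmetric] R12_S13_T23_comb[OF abc] T23_S13_R12_comb[OF abc]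
    by (simp only: braid[unfolded braid_scalars_def])
qed

end

section \<open>The Hom-Yang-Baxter system of a Hom-coalgebra\<close>

context hom_coalgebra
begin

text \<open>The family \<open>F p q\<close> that contains \<open>W\<close>, \<open>X\<close> and \<open>Z\<close>.\<close>

definition coalgebra_op where
  "coalgebra_op p q = tensor_lift K C C CC (\<lambda>a b. (p \<otimes>\<^bsub>K\<^esub> \<epsilon> a) \<odot>\<^bsub>CC\<^esub> \<Delta> b \<oplus>\<^bsub>CC\<^esub>
     (q \<otimes>\<^bsub>K\<^esub> \<epsilon> b) \<odot>\<^bsub>CC\<^esub> \<Delta> a \<ominus>\<^bsub>CC\<^esub> pure_tensor K C C (\<alpha> b) (\<alpha> a))"

sublocale CC: vectorspace K CC by (rule CC_vs)

lemma pure2_closed [simp]: "x \<in> carrier C \<Longrightarrow> y \<in> carrier C \<Longrightarrow> pure_tensor K C C x y \<in> carrier CC"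
  by (rule bilinear_closed[OF pure_tensor_bilinear[OF C_vs C_vs]])

lemma coalgebra_op_bilinear:
  assumes "p \<in> carrier K" "q \<in> carrier K"
  shows "bilinear K C C CC (\<lambda>a b. (p \<otimes>\<^bsub>K\<^esub> \<epsilon> a) \<odot>\<^bsub>CC\<^esub> \<Delta> b \<oplus>\<^bsub>CC\<^esub>
     (q \<otimes>\<^bsub>K\<^esub> \<epsilon> b) \<odot>\<^bsub>CC\<^esub> \<Delta> a \<ominus>\<^bsub>CC\<^esub> pure_tensor K C C (\<alpha> b) (\<alpha> a))"
proof -
  note \<epsilon> = linear_mapD[OF counit_linear, unfolded scalar_space_def, simplified]
  have eps: "linear_map K C CC (\<lambda>a. (k \<otimes>\<^bsub>K\<^esub> \<epsilon> a) \<odot>\<^bsub>CC\<^esub> t)" if "k \<in> carrier K" "t \<in> carrier CC" for k t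
    by (rule linear_mapI[OF C_vs CC_vs])
      (use that in \<open>simp_all add: \<epsilon> R.r_distr CC.smult_l_distr R.m_lcomm flip: CC.smult_assoc1\<close>)
  note pure = pure_tensor_bilinear[OF C_vs C_vs]
  show ?thesis
    by (intro bilinearI linear_map_diff linear_map_plus linear_map_scale eps comult_linear
        linear_map_comp[OF bilinearD(1)[OF pure] twist_linear]
        linear_map_comp[OF bilinearD(2)[OF pure] twist_linear]) (use assms in simp_all)
qed

lemmas coalgebra_op_linear = tensor_lift_linear[OF C_vs C_vs coalgebra_op_bilinear, folded coalgebra_op_def]

text \<open>For the three legs, \<open>L\<close> inserts a tensor of \<open>C \<otimes> C\<close> into two of the factors of \<open>C \<otimes> C \<otimes> C\<close>.\<close>

lemma linear_coalgebra_op: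
  assumes pq: "p \<in> carrier K" "q \<in> carrier K" and L: "linear_map K CC CCC L"
    and a: "a \<in> carrier C" and b: "b \<in> carrier C"
  shows "L (coalgebra_op p q (pure_tensor K C C a b)) =
    p \<odot>\<^bsub>CCC\<^esub> (\<epsilon> a \<odot>\<^bsub>CCC\<^esub> sw (\<lambda>x y. L (pure_tensor K C C x y)) b) \<oplus>\<^bsub>CCC\<^esub>
    q \<odot>\<^bsub>CCC\<^esub> (\<epsilon> b \<odot>\<^bsub>CCC\<^esub> sw (\<lambda>x y. L (pure_tensor K C C x y)) a) \<ominus>\<^bsub>CCC\<^esub>
    L (pure_tensor K C C (\<alpha> b) (\<alpha> a))"
proof -
  have "sw (\<lambda>x y. L (pure_tensor K C C x y)) c = L (\<Delta> c)" if "c \<in> carrier C" for c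
    by (rule linear_map_tensor_lift[OF C_vs C_vs L, symmetric]) (simp add: that)
  moreover have "coalgebra_op p q (pure_tensor K C C a b) = (p \<otimes>\<^bsub>K\<^esub> \<epsilon> a) \<odot>\<^bsub>CC\<^esub> \<Delta> b \<oplus>\<^bsub>CC\<^esub>
     (q \<otimes>\<^bsub>K\<^esub> \<epsilon> b) \<odot>\<^bsub>CC\<^esub> \<Delta> a \<ominus>\<^bsub>CC\<^esub> pure_tensor K C C (\<alpha> b) (\<alpha> a)"
    unfolding coalgebra_op_def
    by (rule tensor_lift_pure[OF C_vs C_vs coalgebra_op_bilinear[OF pq] a b])
  ultimately show ?thesis
    using a b pq by (simp add: linear_mapD[OF L] CCC.smult_assoc1)
qed

definition "op12 f = tensor_map K CC C CC C f \<alpha>"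

definition "op13 f =
  tensor_map K CC C CC C (tensor_flip K C C) (\<lambda>x. x)
    \<circ> (tensor_assoc_inv K C C C \<circ> tensor_map K C CC C CC \<alpha> f \<circ> tensor_assoc K C C C)
    \<circ> tensor_map K CC C CC C (tensor_flip K C C) (\<lambda>x. x)"

definition "op23 f =
  tensor_assoc_inv K C C C \<circ> tensor_map K C CC C CC \<alpha> f \<circ> tensor_assoc K C C C"

lemmas id_linear = linear_map_id[OF C_vs]
lemmas flip_linear = tensor_flip_linear[OF C_vs C_vs]
lemmas assoc_linear = tensor_assoc_linear[OF C_vs C_vs C_vs]
lemmas assoc_inv_linear = tensor_assoc_inv_linear[OF C_vs C_vs C_vs]

lemma flip_tri:
  assumes "a \<in> carrier C" "b \<in> carrier C" "c \<in> carrier C"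
  shows "tensor_map K CC C CC C (tensor_flip K C C) (\<lambda>x. x) (tri a b c) = tri b a c"
  using assms
  by (simp add: tri_def tensor_map_pure[OF flip_linear id_linear] tensor_flip_pure[OF C_vs C_vs])

context
  fixes f assumes f: "linear_map K CC CC f"
begin

lemma op12_linear: "linear_map K CCC CCC (op12 f)"
  unfolding op12_def by (rule tensor_map_linear[OF f twist_linear])

lemma op23_linear: "linear_map K CCC CCC (op23 f)"
  unfolding op23_def comp_def
  by (intro linear_map_comp[OF assoc_inv_linear] linear_map_comp[OF tensor_map_linear[OF twist_linear f]]
      assoc_linear)

lemma op13_linear: "linear_map K CCC CCC (op13 f)"
  using linear_map_comp[OF tensor_map_linear[OF flip_linear id_linear]
      linear_map_comp[OF op23_linear tensor_map_linear[OF flip_linear id_linear]]]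
  by (simp add: op13_def op23_def comp_def)

lemma op12_tri:
  assumes "a \<in> carrier C" "b \<in> carrier C" "c \<in> carrier C"
  shows "op12 f (tri a b c) = pure_tensor K CC C (f (pure_tensor K C C a b)) (\<alpha> c)"
  using assms by (simp add: op12_def tri_def tensor_map_pure[OF f twist_linear])

lemma op23_tri:
  assumes "a \<in> carrier C" "b \<in> carrier C" "c \<in> carrier C"
  shows "op23 f (tri a b c) =
    tensor_assoc_inv K C C C (pure_tensor K C CC (\<alpha> a) (f (pure_tensor K C C b c)))"
  using assms
  by (simp add: op23_def tri_def tensor_assoc_pure_pure[OF C_vs C_vs C_vs] tensor_map_pure[OF twist_linear f])

lemma op13_tri:
  assumes "a \<in> carrier C" "b \<in> carrier C" "c \<in> carrier C"
  shows "op13 f (tri a b c) = tensor_map K CC C CC C (tensor_flip K C C) (\<lambda>x. x)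
    (tensor_assoc_inv K C C C (pure_tensor K C CC (\<alpha> b) (f (pure_tensor K C C a c))))"
proof -
  have "op13 f (tri a b c) = tensor_map K CC C CC C (tensor_flip K C C) (\<lambda>x. x) (op23 f (tri b a c))"
    using assms by (simp add: op13_def op23_def flip_tri)
  then show ?thesis using assms by (simp add: op23_tri)
qed

end

text \<open>The values on pure tensors follow by \<open>linear_coalgebra_op\<close> from the insertions \<open>t \<mapsto> t \<otimes> \<alpha>(z)\<close>,
  \<open>t \<mapsto> \<alpha>(x) \<otimes> t\<close> and, for the outer legs, \<open>t \<mapsto> \<alpha>(y) \<otimes> t\<close> followed by a flip of the first two factors.\<close>

lemma yang_baxter_operators_coalgebra_op:
  assumes c: "p \<in> carrier K" "q \<in> carrier K" "r \<in> carrier K" "s \<in> carrier K"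
    "t \<in> carrier K" "u \<in> carrier K"
  shows "yang_baxter_operators K C \<Delta> \<epsilon> \<alpha> (op12 (coalgebra_op p q)) (op13 (coalgebra_op r s))
    (op23 (coalgebra_op t u)) p q r s t u"
proof (intro yang_baxter_operators.intro yang_baxter_operators_axioms.intro)
  show "hom_coalgebra K C \<Delta> \<epsilon> \<alpha>" by (rule hom_coalgebra_axioms)
  note lin = coalgebra_op_linear[OF c(1,2)] coalgebra_op_linear[OF c(3,4)] coalgebra_op_linear[OF c(5,6)]
  show "linear_map K CCC CCC (op12 (coalgebra_op p q))" "linear_map K CCC CCC (op13 (coalgebra_op r s))"
      "linear_map K CCC CCC (op23 (coalgebra_op t u))"
    by (rule op12_linear op13_linear op23_linear, rule lin)+
  fix x y z assume xyz: "x \<in> carrier C" "y \<in> carrier C" "z \<in> carrier C"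
  note right = bilinearD(2)[OF pure_tensor_bilinear[OF CC_vs C_vs]]
  note left = linear_map_comp[OF assoc_inv_linear bilinearD(1)[OF pure_tensor_bilinear[OF C_vs CC_vs]]]
  note middle = linear_map_comp[OF tensor_map_linear[OF flip_linear id_linear] left]
  have assoc_tri: "tensor_assoc_inv K C C C (pure_tensor K C CC a (pure_tensor K C C b c)) = tri a b c"
    if "a \<in> carrier C" "b \<in> carrier C" "c \<in> carrier C" for a b c
    using that by (simp add: tri_def tensor_assoc_inv_pure_pure[OF C_vs C_vs C_vs])
  show "op12 (coalgebra_op p q) (tri x y z) =
      p \<odot>\<^bsub>CCC\<^esub> (\<epsilon> x \<odot>\<^bsub>CCC\<^esub> sw (\<lambda>a b. tri a b (\<alpha> z)) y) \<oplus>\<^bsub>CCC\<^esub>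
      q \<odot>\<^bsub>CCC\<^esub> (\<epsilon> y \<odot>\<^bsub>CCC\<^esub> sw (\<lambda>a b. tri a b (\<alpha> z)) x) \<ominus>\<^bsub>CCC\<^esub> tri (\<alpha> y) (\<alpha> x) (\<alpha> z)"
    using xyz
    by (simp add: op12_tri[OF lin(1)] linear_coalgebra_op[OF c(1,2) right] flip: tri_def)
  show "op23 (coalgebra_op t u) (tri x y z) =
      t \<odot>\<^bsub>CCC\<^esub> (\<epsilon> y \<odot>\<^bsub>CCC\<^esub> sw (\<lambda>a b. tri (\<alpha> x) a b) z) \<oplus>\<^bsub>CCC\<^esub>
      u \<odot>\<^bsub>CCC\<^esub> (\<epsilon> z \<odot>\<^bsub>CCC\<^esub> sw (\<lambda>a b. tri (\<alpha> x) a b) y) \<ominus>\<^bsub>CCC\<^esub> tri (\<alpha> x) (\<alpha> z) (\<alpha> y)"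
    using xyz
    by (simp add: op23_tri[OF lin(3)] linear_coalgebra_op[OF c(5,6) left] assoc_tri)
  show "op13 (coalgebra_op r s) (tri x y z) =
      r \<odot>\<^bsub>CCC\<^esub> (\<epsilon> x \<odot>\<^bsub>CCC\<^esub> sw (\<lambda>a b. tri a (\<alpha> y) b) z) \<oplus>\<^bsub>CCC\<^esub>
      s \<odot>\<^bsub>CCC\<^esub> (\<epsilon> z \<odot>\<^bsub>CCC\<^esub> sw (\<lambda>a b. tri a (\<alpha> y) b) x) \<ominus>\<^bsub>CCC\<^esub> tri (\<alpha> z) (\<alpha> y) (\<alpha> x)"
    using xyz
    by (simp add: op13_tri[OF lin(2)] linear_coalgebra_op[OF c(3,4) middle] assoc_tri flip_tri)
qed (fact c)+

lemma commutator_coalgebra_op: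
  assumes c: "p \<in> carrier K" "q \<in> carrier K" "r \<in> carrier K" "s \<in> carrier K"
      "t \<in> carrier K" "u \<in> carrier K"
    and braid: "braid_scalars p q r s t u"
  shows "hyb_commutator_zero K C C C \<alpha> \<alpha> \<alpha> (coalgebra_op p q) (coalgebra_op r s) (coalgebra_op t u)"
proof -
  interpret Y: yang_baxter_operators K C \<Delta> \<epsilon> \<alpha> "op12 (coalgebra_op p q)" "op13 (coalgebra_op r s)"
    "op23 (coalgebra_op t u)" p q r s t u
    by (rule yang_baxter_operators_coalgebra_op[OF c])
  have "hyb_commutator K C C C \<alpha> \<alpha> \<alpha> (coalgebra_op p q) (coalgebra_op r s) (coalgebra_op t u) x =
      op12 (coalgebra_op p q) (op13 (coalgebra_op r s) (op23 (coalgebra_op t u) x)) \<ominus>\<^bsub>CCC\<^esub>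
      op23 (coalgebra_op t u) (op13 (coalgebra_op r s) (op12 (coalgebra_op p q) x))" for x
    by (simp add: hyb_commutator_def op12_def op13_def op23_def Let_def)
  then show ?thesis
    using Y.braid_equal[OF braid] by (simp add: hyb_commutator_zero_def Y.op_linear)
qed

end

theorem theorem5p3:
  fixes K :: "('k, 'm) ring_scheme" and C :: "('k, 'c, 'n) module_scheme"
    and \<Delta> :: "'c \<Rightarrow> ('c \<times> 'c \<Rightarrow> 'k) set" and \<epsilon> :: "'c \<Rightarrow> 'k" and \<alpha> :: "'c \<Rightarrow> 'c"
    and lam \<nu> :: 'k
  assumes "hom_coalgebra K C \<Delta> \<epsilon> \<alpha>"
    and "lam \<in> carrier K" and "\<nu> \<in> carrier K"
  shows "let CC = tensor_space K C C;
             W = tensor_lift K C C CC (\<lambda>a b. (lam \<otimes>\<^bsub>K\<^esub> \<epsilon> a) \<odot>\<^bsub>CC\<^esub> \<Delta> b \<oplus>\<^bsub>CC\<^esub> \<epsilon> b \<odot>\<^bsub>CC\<^esub> \<Delta> a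
                   \<ominus>\<^bsub>CC\<^esub> pure_tensor K C C (\<alpha> b) (\<alpha> a));
             Z = tensor_lift K C C CC (\<lambda>a b. \<epsilon> a \<odot>\<^bsub>CC\<^esub> \<Delta> b \<oplus>\<^bsub>CC\<^esub> (\<nu> \<otimes>\<^bsub>K\<^esub> \<epsilon> b) \<odot>\<^bsub>CC\<^esub> \<Delta> a
                   \<ominus>\<^bsub>CC\<^esub> pure_tensor K C C (\<alpha> b) (\<alpha> a));
             X = tensor_lift K C C CC (\<lambda>a b. \<epsilon> a \<odot>\<^bsub>CC\<^esub> \<Delta> b \<oplus>\<^bsub>CC\<^esub> \<epsilon> b \<odot>\<^bsub>CC\<^esub> \<Delta> a
                   \<ominus>\<^bsub>CC\<^esub> pure_tensor K C C (\<alpha> b) (\<alpha> a))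
         in hom_yang_baxter_system K C C \<alpha> \<alpha> W Z X"
proof -
  interpret hom_coalgebra K C \<Delta> \<epsilon> \<alpha> by fact
  note scalars [simp] = assms(2,3)
  have cancel: "x \<oplus>\<^bsub>K\<^esub> \<one>\<^bsub>K\<^esub> \<ominus>\<^bsub>K\<^esub> \<one>\<^bsub>K\<^esub> = x" "\<one>\<^bsub>K\<^esub> \<oplus>\<^bsub>K\<^esub> x \<ominus>\<^bsub>K\<^esub> \<one>\<^bsub>K\<^esub> = x" "x \<ominus>\<^bsub>K\<^esub> x = \<zero>\<^bsub>K\<^esub>"
    if "x \<in> carrier K" for x
  proof -
    show "x \<oplus>\<^bsub>K\<^esub> \<one>\<^bsub>K\<^esub> \<ominus>\<^bsub>K\<^esub> \<one>\<^bsub>K\<^esub> = x" using that by (simp add: a_minus_def R.a_assoc R.r_neg)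
    then show "\<one>\<^bsub>K\<^esub> \<oplus>\<^bsub>K\<^esub> x \<ominus>\<^bsub>K\<^esub> \<one>\<^bsub>K\<^esub> = x" using that by (simp add: R.a_comm)
    show "x \<ominus>\<^bsub>K\<^esub> x = \<zero>\<^bsub>K\<^esub>" using that by simp
  qed
  have zero_cancel: "\<zero>\<^bsub>K\<^esub> \<ominus>\<^bsub>K\<^esub> x \<oplus>\<^bsub>K\<^esub> y = y \<ominus>\<^bsub>K\<^esub> x"
    if "x \<in> carrier K" "y \<in> carrier K" for x y
    using that by (simp add: a_minus_def R.a_comm)
  have WWW: "hyb_commutator_zero K C C C \<alpha> \<alpha> \<alpha> (coalgebra_op lam \<one>\<^bsub>K\<^esub>) (coalgebra_op lam \<one>\<^bsub>K\<^esub>) (coalgebra_op lam \<one>\<^bsub>K\<^esub>)"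
    by (rule commutator_coalgebra_op) (simp_all add: braid_scalars_def cancel zero_cancel)
  have ZZZ: "hyb_commutator_zero K C C C \<alpha> \<alpha> \<alpha> (coalgebra_op \<one>\<^bsub>K\<^esub> \<nu>) (coalgebra_op \<one>\<^bsub>K\<^esub> \<nu>) (coalgebra_op \<one>\<^bsub>K\<^esub> \<nu>)"
    by (rule commutator_coalgebra_op) (simp_all add: braid_scalars_def cancel zero_cancel)
  have WXX: "hyb_commutator_zero K C C C \<alpha> \<alpha> \<alpha> (coalgebra_op lam \<one>\<^bsub>K\<^esub>) (coalgebra_op \<one>\<^bsub>K\<^esub> \<one>\<^bsub>K\<^esub>) (coalgebra_op \<one>\<^bsub>K\<^esub> \<one>\<^bsub>K\<^esub>)"
    by (rule commutator_coalgebra_op) (simp_all add: braid_scalars_def cancel zero_cancel)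
  have XXZ: "hyb_commutator_zero K C C C \<alpha> \<alpha> \<alpha> (coalgebra_op \<one>\<^bsub>K\<^esub> \<one>\<^bsub>K\<^esub>) (coalgebra_op \<one>\<^bsub>K\<^esub> \<one>\<^bsub>K\<^esub>) (coalgebra_op \<one>\<^bsub>K\<^esub> \<nu>)"
    by (rule commutator_coalgebra_op) (simp_all add: braid_scalars_def cancel zero_cancel)
  \<comment> \<open>A counit that stands without a scalar in \<open>W\<close>, \<open>Z\<close> or \<open>X\<close> has the scalar \<open>\<one>\<close> in the family.\<close>
  have W: "tensor_lift K C C CC (\<lambda>a b. (lam \<otimes>\<^bsub>K\<^esub> \<epsilon> a) \<odot>\<^bsub>CC\<^esub> \<Delta> b \<oplus>\<^bsub>CC\<^esub> \<epsilon> b \<odot>\<^bsub>CC\<^esub> \<Delta> a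
      \<ominus>\<^bsub>CC\<^esub> pure_tensor K C C (\<alpha> b) (\<alpha> a)) = coalgebra_op lam \<one>\<^bsub>K\<^esub>"
    unfolding coalgebra_op_def by (rule tensor_lift_cong) simp
  have Z: "tensor_lift K C C CC (\<lambda>a b. \<epsilon> a \<odot>\<^bsub>CC\<^esub> \<Delta> b \<oplus>\<^bsub>CC\<^esub> (\<nu> \<otimes>\<^bsub>K\<^esub> \<epsilon> b) \<odot>\<^bsub>CC\<^esub> \<Delta> a
      \<ominus>\<^bsub>CC\<^esub> pure_tensor K C C (\<alpha> b) (\<alpha> a)) = coalgebra_op \<one>\<^bsub>K\<^esub> \<nu>"
    unfolding coalgebra_op_def by (rule tensor_lift_cong) simp
  have X: "tensor_lift K C C CC (\<lambda>a b. \<epsilon> a \<odot>\<^bsub>CC\<^esub> \<Delta> b \<oplus>\<^bsub>CC\<^esub> \<epsilon> b \<odot>\<^bsub>CC\<^esub> \<Delta> a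
      \<ominus>\<^bsub>CC\<^esub> pure_tensor K C C (\<alpha> b) (\<alpha> a)) = coalgebra_op \<one>\<^bsub>K\<^esub> \<one>\<^bsub>K\<^esub>"
    unfolding coalgebra_op_def by (rule tensor_lift_cong) simp
  show ?thesis
    unfolding Let_def W Z X hom_yang_baxter_system_def
    using WWW ZZZ WXX XXZ by (simp add: twist_linear coalgebra_op_linear)
qed

end
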